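(* For positive integers $m\ge n$ the following equality holds: $$\varsigma(\mathcal{P}_{n,m})=\sum_{i=1}^{n}\ \sum_{k=\max\{0,\,2i-m\}}^{i-1}\ \sum_{j=0}^{\min\{n-i,\,m-2i+k\}}\binom{m}{k}\left(1-\frac12\delta_{0,j}\right)\frac{i-k-\delta_{0,j}}{i+j-k+1}\binom{m-k}{2i+j-2k}\binom{2i+j-2k}{i-k},$$ where $\delta_{0,j}$ is the Kronecker delta.
   Context: Let $\mathbb{K}$ be an algebraically closed field of characteristic zero. A semistandard Young tableau of partition shape $\lambda$ is a filling of the Ferrers diagram of $\lambda$ (English notation) with positive integers, strictly increasing down columns and weakly increasing from left to right along rows. For positive integers $m\ge n$, $\mathrm{SSYT}_m^n$ denotes the set of all semistandard Young tableaux of all partition shapes with at most $n$ rows and with entries in $\{1,\dots,m\}$. For $T$ of shape $\lambda$ and $T'$ of shape $\mu$, $T\star T'$ is the semistandard Young tableau of shape $\lambda+\mu$ obtained by horizontally concatenating the rows of $T$ and $T'$ and sorting the entries in each row in weakly increasing order. Let $G_{n,m}$ be the set of tableaux in $\mathrm{SSYT}_m^n$ with exactly one column (of height $1,\dots,n$), and $\mathbb{K}[G_{n,m}]$ the polynomial ring in commuting variables indexed by $G_{n,m}$. $\mathcal{P}_{n,m}$ is the ideal of $\mathbb{K}[G_{n,m}]$ generated by all $T_1T_2-T_3T_4$ with $T_1,T_2,T_3,T_4\in G_{n,m}$ distinct and $T_1\star T_2=T_3\star T_4$. $\varsigma(\mathcal{P}_{n,m})$ denotes the cardinality of a minimal generating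 set for the ideal $\mathcal{P}_{n,m}$, i.e. the minimal number of generators. *)

theory Defs
  imports
    "HOL-Algebra.Ideal"
    "HOL-Library.Poly_Mapping"
    "HOL-Computational_Algebra.Polynomial"
begin

section \<open>Semistandard tableaux\<close>

text \<open>A tableau is the list of its nonempty rows, from top to bottom; the empty list is the
  tableau of empty shape.\<close>

type_synonym tableau = "nat list list"

text \<open>Rows below the last one are empty, as the parts of a partition after the last
  positive one are zero.\<close>

definition row :: "tableau \<Rightarrow> nat \<Rightarrow> nat list" where
  "row T r = (if r < length T then T ! r else [])"

definition semistandard :: "tableau \<Rightarrow> bool" where
  "semistandard T \<longleftrightarrow>
     [] \<notin> set T \<and>
     (\<forall>r. length (row T (Suc r)) \<le> length (row T r)) \<and>
     (\<forall>r. sorted (row T r)) \<and>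
     (\<forall>r c. c < length (row T (Suc r)) \<longrightarrow> row T r ! c < row T (Suc r) ! c) \<and>
     (\<forall>r. \<forall>x \<in> set (row T r). 1 \<le> x)"

definition SSYT :: "nat \<Rightarrow> nat \<Rightarrow> tableau set" where
  "SSYT m n = {T. semistandard T \<and> length T \<le> n \<and> (\<forall>R \<in> set T. set R \<subseteq> {1..m})}"

definition star :: "tableau \<Rightarrow> tableau \<Rightarrow> tableau" (infixl \<open>\<star>\<close> 70) where
  "T \<star> T' = map (\<lambda>r. sort (row T r @ row T' r)) [0..<max (length T) (length T')]"

text \<open>The number of columns of a tableau is the length of its first row.\<close>

definition one_column_tableaux :: "nat \<Rightarrow> nat \<Rightarrow> tableau set" where
  "one_column_tableaux n m = {T \<in> SSYT m n. length (row T 0) = 1}"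

section \<open>Polynomial rings\<close>

text \<open>A monomial in indeterminates of type \<^typ>\<open>'x\<close> is its finitely supported exponent
  function, and a polynomial is the finitely supported function from monomials to
  coefficients.\<close>

type_synonym ('x, 'k) mvpoly = "('x \<Rightarrow>\<^sub>0 nat) \<Rightarrow>\<^sub>0 'k"

definition Var :: "'x \<Rightarrow> ('x, 'k::comm_ring_1) mvpoly" where
  "Var x = Poly_Mapping.single (Poly_Mapping.single x 1) 1"

text \<open>Polynomials over \<^typ>\<open>'k\<close> involving only the indeterminates in \<^term>\<open>X\<close>.\<close>

definition mvpoly_ring :: "'x set \<Rightarrow> ('x, 'k::comm_ring_1) mvpoly ring" where
  "mvpoly_ring X =
     \<lparr>carrier = {p. \<forall>t \<in> Poly_Mapping.keys p. Poly_Mapping.keys t \<subseteq> X},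
      monoid.mult = (*), one = 1, zero = 0, add = (+)\<rparr>"

lemma mvpoly_ring_simps [simp]:
  "carrier (mvpoly_ring X) = {p. \<forall>t \<in> Poly_Mapping.keys p. Poly_Mapping.keys t \<subseteq> X}"
  "p \<otimes>\<^bsub>mvpoly_ring X\<^esub> q = p * q"
  "\<one>\<^bsub>mvpoly_ring X\<^esub> = 1"
  "\<zero>\<^bsub>mvpoly_ring X\<^esub> = 0"
  "p \<oplus>\<^bsub>mvpoly_ring X\<^esub> q = p + q"
  by (simp_all add: mvpoly_ring_def)

lemma cring_mvpoly_ring: "cring (mvpoly_ring X :: ('x, 'k::comm_ring_1) mvpoly ring)"
proof (rule cringI)
  show "abelian_group (mvpoly_ring X :: ('x, 'k) mvpoly ring)"
  proof (rule abelian_groupI)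
    fix p q :: "('x, 'k) mvpoly"
    assume "p \<in> carrier (mvpoly_ring X)" "q \<in> carrier (mvpoly_ring X)"
    then show "p \<oplus>\<^bsub>mvpoly_ring X\<^esub> q \<in> carrier (mvpoly_ring X)"
      using keys_add[of p q] by auto
  next
    fix p :: "('x, 'k) mvpoly"
    assume "p \<in> carrier (mvpoly_ring X)"
    then have "- p \<in> carrier (mvpoly_ring X)"
      by (auto simp: in_keys_iff)
    moreover have "- p \<oplus>\<^bsub>mvpoly_ring X\<^esub> p = \<zero>\<^bsub>mvpoly_ring X\<^esub>"
      by simp
    ultimately show "\<exists>q \<in> carrier (mvpoly_ring X). q \<oplus>\<^bsub>mvpoly_ring X\<^esub> p = \<zero>\<^bsub>mvpoly_ring X\<^esub>"
      by blast
  qed (simp_all add: ac_simps)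
  have mult_closed: "p * q \<in> carrier (mvpoly_ring X)"
    if that_p: "p \<in> carrier (mvpoly_ring X)" and that_q: "q \<in> carrier (mvpoly_ring X)" for p q :: "('x, 'k) mvpoly"
  proof -
    have "Poly_Mapping.keys t \<subseteq> X" if "t \<in> Poly_Mapping.keys (p * q)" for t
    proof -
      obtain a b where "a \<in> Poly_Mapping.keys p" "b \<in> Poly_Mapping.keys q" "t = a + b"
        using \<open>t \<in> Poly_Mapping.keys (p * q)\<close> keys_mult[of p q] by blast
      then have "Poly_Mapping.keys a \<subseteq> X" "Poly_Mapping.keys b \<subseteq> X"
        using that_p that_q by auto
      then show ?thesis
        unfolding \<open>t = a + b\<close> using keys_add[of a b] by blast
    qed
    then show ?thesis by auto
  qed
  show "Group.comm_monoid (mvpoly_ring X :: ('x, 'k) mvpoly ring)"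
  proof (rule comm_monoidI)
    fix p q :: "('x, 'k) mvpoly"
    assume "p \<in> carrier (mvpoly_ring X)" "q \<in> carrier (mvpoly_ring X)"
    then show "p \<otimes>\<^bsub>mvpoly_ring X\<^esub> q \<in> carrier (mvpoly_ring X)"
      unfolding mvpoly_ring_simps(2) by (rule mult_closed)
  qed (simp_all add: ac_simps)
qed (simp add: distrib_right)

section \<open>The ideal of relations and its number of generators\<close>

definition star_relations :: "nat \<Rightarrow> nat \<Rightarrow> (tableau, 'k::comm_ring_1) mvpoly set" where
  "star_relations n m =
     {Var T\<^sub>1 * Var T\<^sub>2 - Var T\<^sub>3 * Var T\<^sub>4 | T\<^sub>1 T\<^sub>2 T\<^sub>3 T\<^sub>4.
        {T\<^sub>1, T\<^sub>2, T\<^sub>3, T\<^sub>4} \<subseteq> one_column_tableaux n m \<and>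
        distinct [T\<^sub>1, T\<^sub>2, T\<^sub>3, T\<^sub>4] \<and> T\<^sub>1 \<star> T\<^sub>2 = T\<^sub>3 \<star> T\<^sub>4}"

definition star_ideal :: "nat \<Rightarrow> nat \<Rightarrow> (tableau, 'k::comm_ring_1) mvpoly set" where
  "star_ideal n m = Idl\<^bsub>mvpoly_ring (one_column_tableaux n m)\<^esub> star_relations n m"

definition min_generators :: "('a, 'b) ring_scheme \<Rightarrow> 'a set \<Rightarrow> nat" where
  "min_generators R I = (LEAST k. \<exists>S \<subseteq> carrier R. finite S \<and> card S = k \<and> Idl\<^bsub>R\<^esub> S = I)"

text \<open>The minimum in \<^const>\<open>min_generators\<close> is attained for \<^const>\<open>star_ideal\<close>,
  since the defining generating set is finite.\<close>

lemma finite_one_column_tableaux: "finite (one_column_tableaux n m)"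
proof (rule finite_subset)
  let ?rows = "{R. set R \<subseteq> {1..m} \<and> length R \<le> 1}"
  show "finite {T. set T \<subseteq> ?rows \<and> length T \<le> n}"
    by (intro finite_lists_length_le) auto
  show "one_column_tableaux n m \<subseteq> {T. set T \<subseteq> ?rows \<and> length T \<le> n}"
  proof
    fix T assume T: "T \<in> one_column_tableaux n m"
    have "length (row T r) \<le> 1" for r
    proof (induction r)
      case 0
      then show ?case using T by (simp add: one_column_tableaux_def)
    next
      case (Suc r)
      have "length (row T (Suc r)) \<le> length (row T r)"
        using T by (simp add: one_column_tableaux_def SSYT_def semistandard_def)
      then show ?case using Suc by linarith
    qed
    then have "\<forall>R \<in> set T. length R \<le> 1"
      by (metis in_set_conv_nth row_def)
    then show "T \<in> {T. set T \<subseteq> ?rows \<and> length T \<le> n}"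
      using T by (auto simp: one_column_tableaux_def SSYT_def)
  qed
qed

lemma finite_star_relations: "finite (star_relations n m :: (tableau, 'k::comm_ring_1) mvpoly set)"
proof (rule finite_subset)
  let ?G = "one_column_tableaux n m"
  show "star_relations n m \<subseteq> (\<lambda>(T\<^sub>1, T\<^sub>2, T\<^sub>3, T\<^sub>4). Var T\<^sub>1 * Var T\<^sub>2 - Var T\<^sub>3 * Var T\<^sub>4) `
    (?G \<times> ?G \<times> ?G \<times> ?G)"
    unfolding star_relations_def by force
qed (simp add: finite_one_column_tableaux)

lemma star_relations_carrier:
  "star_relations n m \<subseteq> carrier (mvpoly_ring (one_column_tableaux n m) :: (tableau, 'k::comm_ring_1) mvpoly ring)"
proof
  fix p :: "(tableau, 'k) mvpoly"
  assume "p \<in> star_relations n m"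
  then obtain T1 T2 T3 T4 where p: "p = Var T1 * Var T2 - Var T3 * Var T4"
    and T: "{T1, T2, T3, T4} \<subseteq> one_column_tableaux n m"
    unfolding star_relations_def by blast
  let ?mon = "\<lambda>T T' :: tableau. Poly_Mapping.single T 1 + Poly_Mapping.single T' (1 :: nat)"
  have Var_mult: "Var T * Var T' = (Poly_Mapping.single (?mon T T') 1 :: (tableau, 'k) mvpoly)" for T T'
    by (simp add: Var_def mult_single)
  have "Poly_Mapping.keys t \<subseteq> one_column_tableaux n m" if "t \<in> Poly_Mapping.keys p" for t
  proof -
    have "t \<in> {?mon T1 T2, ?mon T3 T4}"
      using that keys_diff[of "Var T1 * Var T2" "Var T3 * Var T4 :: (tableau, 'k) mvpoly"]
      unfolding p Var_mult by (auto split: if_splits)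
    then have "Poly_Mapping.keys t \<subseteq> {T1, T2, T3, T4}"
      using keys_add[of "Poly_Mapping.single T1 (1 :: nat)" "Poly_Mapping.single T2 1"]
        keys_add[of "Poly_Mapping.single T3 (1 :: nat)" "Poly_Mapping.single T4 1"]
      by auto
    then show ?thesis using T by (rule subset_trans)
  qed
  then show "p \<in> carrier (mvpoly_ring (one_column_tableaux n m))"
    unfolding mvpoly_ring_simps(1) by blast
qed

lemma star_ideal_finitely_generated:
  "\<exists>S \<subseteq> carrier (mvpoly_ring (one_column_tableaux n m)). finite S \<and>
     Idl\<^bsub>mvpoly_ring (one_column_tableaux n m)\<^esub> S = star_ideal n m"
  by (intro exI[of _ "star_relations n m"] conjI star_relations_carrier finite_star_relations
      star_ideal_def[symmetric])

end

theory Submission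
  imports
    Defs
    "HOL-Library.Function_Algebras"
    "HOL-Library.Extended_Nat"
    "HOL-Library.Multiset"
begin

text \<open>The generators of the ideal are differences of quadratic monomials, so the ideal starts in degree
two, and modulo the part of degree three and more a combination
\<open>\<Sum> r\<^sub>s s\<close> of generators only sees the constant terms of the coefficients \<open>r\<^sub>s\<close>. Every generating set
therefore has quadratic parts that span the quadratic part of the ideal, and conversely a basis of
that part generates. Grouping the quadratic monomials \<open>T\<^sub>1 T\<^sub>2\<close> by the value of \<open>T\<^sub>1 \<star> T\<^sub>2\<close>, the
quadratic part has dimension \<open>number of monomials - number of values\<close>
(\<open>min_generators_binomial_ideal\<close>).

A column is a finite set \<open>A\<close>, listed increasingly and continued by \<open>\<infinity>\<close> below its last entry
(\<open>entry A\<close>). In these terms the rows of \<open>T\<^sub>1 \<star> T\<^sub>2\<close> record the pointwise minimum and maximum of two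
entry functions. The columns form a distributive lattice under the pointwise order, each value of
\<open>\<star>\<close> is attained by exactly one comparable pair, namely meet and join, and the number of generators is
the number of unordered incomparable pairs of columns (\<open>card_incomparable_pairs\<close>). The ideal
is the Hibi ideal of this lattice.

To count these pairs, fix \<open>K = A \<inter> B\<close> and the symmetric difference \<open>U\<close> of \<open>A\<close> and \<open>B\<close>. Whether
\<open>A\<close> lies below \<open>B\<close> depends only on the position of \<open>B - A\<close> inside \<open>U\<close>: every initial segment of
\<open>U\<close> has to contain at least as many elements of \<open>A - B\<close> as of \<open>B - A\<close>. This is the ballot condition,
so that \<open>ballot_theorem\<close> counts the admissible positions. In the final sum \<open>i\<close> is the smaller of
the two heights, \<open>i + j\<close> the larger one and \<open>k\<close> the size of \<open>K\<close>; the factor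
\<open>1 - \<delta>\<^sub>0\<^sub>j / 2\<close> undoes the double counting of unordered pairs of equal height.\<close>

section \<open>Lowest homogeneous parts of ideals\<close>

definition total_degree :: "('x \<Rightarrow>\<^sub>0 nat) \<Rightarrow> nat" where
  "total_degree t = (\<Sum>x\<in>Poly_Mapping.keys t. Poly_Mapping.lookup t x)"

lemma total_degree_eq_sum:
  "finite X \<Longrightarrow> Poly_Mapping.keys t \<subseteq> X \<Longrightarrow> total_degree t = (\<Sum>x\<in>X. Poly_Mapping.lookup t x)"
  unfolding total_degree_def by (rule sum.mono_neutral_left) (auto simp: in_keys_iff)

lemma total_degree_add: "total_degree (s + t) = total_degree s + total_degree t"
proof -
  let ?X = "Poly_Mapping.keys s \<union> Poly_Mapping.keys t"
  have "total_degree u = (\<Sum>x\<in>?X. Poly_Mapping.lookup u x)" if "Poly_Mapping.keys u \<subseteq> ?X" for u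
    using that by (intro total_degree_eq_sum) auto
  then show ?thesis
    using keys_add[of s t] by (simp add: lookup_add sum.distrib)
qed

lemma total_degree_single [simp]: "total_degree (Poly_Mapping.single x k) = k"
  by (simp add: total_degree_def)

lemma total_degree_eq_0_iff: "total_degree t = 0 \<longleftrightarrow> t = 0"
  by (auto simp: total_degree_def in_keys_iff intro!: poly_mapping_eqI)

text \<open>If nothing in \<open>p\<close> has degree below \<open>d\<close>, a factor of positive degree pushes everything in \<open>p\<close>
beyond degree \<open>d\<close>, and only the constant term of \<open>r\<close> reaches degree \<open>d\<close>.\<close>

lemma lookup_mult_lowest_degree:
  fixes p r :: "('x, 'k::comm_ring_1) mvpoly"
  assumes low: "\<And>u. u \<in> Poly_Mapping.keys p \<Longrightarrow> d \<le> total_degree u"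
    and t: "total_degree t = d"
  shows "Poly_Mapping.lookup (r * p) t = Poly_Mapping.lookup r 0 * Poly_Mapping.lookup p t"
proof -
  have *: "(\<Sum>u. Poly_Mapping.lookup p u when t = l + u) = (Poly_Mapping.lookup p t when l = 0)"
    for l :: "'x \<Rightarrow>\<^sub>0 nat"
  proof (cases "l = 0")
    case True
    then show ?thesis by simp
  next
    case False
    have "Poly_Mapping.lookup p u = 0" if "t = l + u" for u
    proof -
      have "total_degree u < d"
        using False t that total_degree_eq_0_iff[of l] by (simp add: total_degree_add)
      then show ?thesis using low by (meson in_keys_iff not_le)
    qed
    then have "(Poly_Mapping.lookup p u when t = l + u) = 0" for u
      by (simp add: when_def)
    then show ?thesis using False by simp
  qed
  have "Poly_Mapping.lookup (r * p) t
      = (\<Sum>l. Poly_Mapping.lookup r l * (Poly_Mapping.lookup p t when l = 0))"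
    by (simp only: lookup_mult *)
  also have "\<dots> = Poly_Mapping.lookup r 0 * Poly_Mapping.lookup p t"
    by (simp add: mult_when)
  finally show ?thesis .
qed

text \<open>Polynomials are compared through their coefficients at a chosen set of monomials. The values are
plain functions, which form a vector space; linear algebra takes place there.\<close>

definition coordinates :: "'a set \<Rightarrow> ('a \<Rightarrow>\<^sub>0 'k::zero) \<Rightarrow> 'a \<Rightarrow> 'k" where
  "coordinates N p t = (if t \<in> N then Poly_Mapping.lookup p t else 0)"

interpretation fun_space: vector_space "\<lambda>(c::'k::field) f x :: 'a. c * f x"
  by standard (auto simp: algebra_simps fun_eq_iff)

lemma a_inv_mvpoly_ring:
  assumes "p \<in> carrier (mvpoly_ring X)"
  shows "\<ominus>\<^bsub>mvpoly_ring X\<^esub> p = - (p :: ('x, 'k::comm_ring_1) mvpoly)"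
proof -
  interpret cring "mvpoly_ring X :: ('x, 'k) mvpoly ring" by (rule cring_mvpoly_ring)
  have "- p \<in> carrier (mvpoly_ring X)"
    using assms by (auto simp: in_keys_iff)
  then show ?thesis
    using assms by (intro minus_equality) (auto simp del: mvpoly_ring_simps(1))
qed

text \<open>Closure under negation is automatic, being multiplication by \<open>- 1\<close>.\<close>

lemma idealI_mvpoly_ring:
  fixes J :: "('x, 'k::comm_ring_1) mvpoly set"
  assumes "J \<subseteq> carrier (mvpoly_ring X)" and "0 \<in> J"
    and "\<And>p q. p \<in> J \<Longrightarrow> q \<in> J \<Longrightarrow> p + q \<in> J"
    and mult: "\<And>r p. r \<in> carrier (mvpoly_ring X) \<Longrightarrow> p \<in> J \<Longrightarrow> r * p \<in> J"
  shows "ideal J (mvpoly_ring X)"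
proof -
  interpret cring "mvpoly_ring X :: ('x, 'k) mvpoly ring" by (rule cring_mvpoly_ring)
  have "- 1 \<in> carrier (mvpoly_ring X :: ('x, 'k) mvpoly ring)"
    by (auto simp: in_keys_iff lookup_one when_def split: if_splits)
  then have "- p \<in> J" if "p \<in> J" for p
    using mult[of "- 1" p] that by simp
  moreover have "\<ominus>\<^bsub>mvpoly_ring X\<^esub> p = - p" if "p \<in> J" for p
    using a_inv_mvpoly_ring that assms(1) by blast
  ultimately have "subgroup J (add_monoid (mvpoly_ring X))"
    using assms(1-3) a_inv_def
    by (intro group.subgroupI[OF a_group]) (auto simp: a_inv_def)
  moreover have "p * r \<in> J" if "r \<in> carrier (mvpoly_ring X)" "p \<in> J" for r p
    using mult[OF that] by (simp add: mult.commute)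
  ultimately show ?thesis
    using mult by (intro idealI ring_axioms) (auto simp del: mvpoly_ring_simps(1))
qed

text \<open>In lowest degree multiplication acts through scalars, hence a linear condition on the coefficients of
degree \<open>d\<close> cuts out an ideal. Taking for \<open>W\<close> the span of the coordinates of a set of generators bounds
what these generators can produce.\<close>

lemma ideal_lowest_degree:
  fixes W :: "(('x \<Rightarrow>\<^sub>0 nat) \<Rightarrow> 'k::field) set"
  assumes W: "fun_space.subspace W" and N: "\<And>t. t \<in> N \<Longrightarrow> total_degree t = d"
  shows "ideal {p \<in> carrier (mvpoly_ring X). (\<forall>u\<in>Poly_Mapping.keys p. d \<le> total_degree u) \<and>
    coordinates N p \<in> W} (mvpoly_ring X)" (is "ideal ?J _")
proof (rule idealI_mvpoly_ring)
  interpret cring "mvpoly_ring X :: ('x, 'k) mvpoly ring" by (rule cring_mvpoly_ring)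
  have "coordinates N 0 = (0 :: ('x \<Rightarrow>\<^sub>0 nat) \<Rightarrow> 'k)"
    by (auto simp: coordinates_def)
  then show "0 \<in> ?J"
    using fun_space.subspace_0[OF W] by simp
  fix p assume p: "p \<in> ?J"
  show "p + q \<in> ?J" if q: "q \<in> ?J" for q
  proof -
    have "coordinates N (p + q) = coordinates N p + coordinates N q"
      by (auto simp: coordinates_def lookup_add)
    moreover have "p + q \<in> carrier (mvpoly_ring X)"
      using p q add.m_closed[of p q] by (simp del: mvpoly_ring_simps(1))
    ultimately show ?thesis
      using p q keys_add[of p q] fun_space.subspace_add[OF W] by fastforce
  qed
  show "r * p \<in> ?J" if r: "r \<in> carrier (mvpoly_ring X)" for r
  proof -
    have "coordinates N (r * p) = (\<lambda>t. Poly_Mapping.lookup r 0 * coordinates N p t)"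
    proof
      fix t
      show "coordinates N (r * p) t = Poly_Mapping.lookup r 0 * coordinates N p t"
        using lookup_mult_lowest_degree[of p d t r] p N by (simp add: coordinates_def)
    qed
    then have "coordinates N (r * p) \<in> W"
      using p fun_space.subspace_scale[OF W] by simp
    moreover have "r * p \<in> carrier (mvpoly_ring X)"
      using p r m_closed[of r p] by (simp del: mvpoly_ring_simps(1))
    moreover have "d \<le> total_degree u" if u: "u \<in> Poly_Mapping.keys (r * p)" for u
    proof -
      obtain a b where "b \<in> Poly_Mapping.keys p" "u = a + b"
        using u keys_mult[of r p] by blast
      then show ?thesis using p by (fastforce simp: total_degree_add)
    qed
    ultimately show ?thesis by blast
  qed
qed blast

text \<open>The coordinates of the generators span a space that contains the unit vectors of all monomials in
\<open>N\<close>, and there are \<open>card N\<close> of these.\<close>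

lemma card_le_generators:
  fixes S :: "('x, 'k::field) mvpoly set"
  assumes S: "finite S" "S \<subseteq> carrier (mvpoly_ring X)"
    and low: "\<And>p u. p \<in> S \<Longrightarrow> u \<in> Poly_Mapping.keys p \<Longrightarrow> d \<le> total_degree u"
    and N: "\<And>t. t \<in> N \<Longrightarrow> total_degree t = d"
    and delta: "\<And>t. t \<in> N \<Longrightarrow>
      \<exists>p \<in> Idl\<^bsub>mvpoly_ring X\<^esub> S. \<forall>u\<in>N. Poly_Mapping.lookup p u = of_bool (u = t)"
  shows "card N \<le> card S"
proof -
  interpret cring "mvpoly_ring X :: ('x, 'k) mvpoly ring" by (rule cring_mvpoly_ring)
  let ?W = "fun_space.span (coordinates N ` S)"
  let ?\<delta> = "\<lambda>t u :: 'x \<Rightarrow>\<^sub>0 nat. of_bool (u = t) :: 'k"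
  have sub: "fun_space.subspace ?W"
    by (rule fun_space.subspace_span)
  have "S \<subseteq> {p \<in> carrier (mvpoly_ring X). (\<forall>u\<in>Poly_Mapping.keys p. d \<le> total_degree u) \<and>
      coordinates N p \<in> ?W}"
    using S(2) low fun_space.span_base by blast
  note gen = genideal_minimal[OF ideal_lowest_degree[OF sub N] this]
  have "?\<delta> ` N \<subseteq> ?W"
  proof
    fix f assume "f \<in> ?\<delta> ` N"
    then obtain t where t: "t \<in> N" "f = ?\<delta> t" by blast
    then obtain p where p: "p \<in> Idl\<^bsub>mvpoly_ring X\<^esub> S" "\<forall>u\<in>N. Poly_Mapping.lookup p u = of_bool (u = t)"
      using delta by blast
    then have "coordinates N p = f"
      using t by (auto simp: coordinates_def fun_eq_iff)
    then show "f \<in> ?W"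
      using gen p(1) by blast
  qed
  moreover have "fun_space.independent (?\<delta> ` N)"
    unfolding fun_space.dependent_def
  proof
    assume "\<exists>f\<in>?\<delta> ` N. f \<in> fun_space.span (?\<delta> ` N - {f})"
    then obtain t where t: "t \<in> N" "?\<delta> t \<in> fun_space.span (?\<delta> ` N - {?\<delta> t})" by blast
    \<comment> \<open>All other unit vectors vanish at \<open>t\<close>.\<close>
    have "fun_space.span (?\<delta> ` N - {?\<delta> t}) \<subseteq> {f. f t = 0}"
      by (rule fun_space.span_minimal) (auto simp: fun_space.subspace_def)
    then show False using t(2) by auto
  qed
  ultimately have "card (?\<delta> ` N) \<le> card (coordinates N ` S)"
    using fun_space.independent_span_bound S(1) by blast
  also have "\<dots> \<le> card S"
    using S(1) by (rule card_image_le)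
  moreover have "inj_on ?\<delta> N"
  proof (rule inj_onI)
    fix s t assume "?\<delta> s = ?\<delta> t"
    then have "?\<delta> s s = ?\<delta> t s" by (rule fun_cong)
    then show "s = t" by (simp split: if_splits)
  qed
  ultimately show ?thesis by (simp add: card_image)
qed


section \<open>Ideals generated by differences of monomials\<close>

text \<open>Choose one representative monomial in each fibre of \<open>f\<close>. The differences of the other monomials to
their representatives generate, since subtracting two of them gives the difference of any two monomials
of a fibre. No smaller set suffices: on the monomials other than the representatives these differences are the unit
vectors.\<close>

lemma min_generators_binomial_ideal:
  fixes M :: "('x \<Rightarrow>\<^sub>0 nat) set" and f :: "('x \<Rightarrow>\<^sub>0 nat) \<Rightarrow> 'c"
  assumes fin: "finite M"
    and deg: "\<And>t. t \<in> M \<Longrightarrow> total_degree t = d"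
    and vars: "\<And>t. t \<in> M \<Longrightarrow> Poly_Mapping.keys t \<subseteq> X"
  defines "R \<equiv> {Poly_Mapping.single t 1 - Poly_Mapping.single u 1 | t u.
    t \<in> M \<and> u \<in> M \<and> t \<noteq> u \<and> f t = f u} :: ('x, 'k::field) mvpoly set"
  shows "min_generators (mvpoly_ring X) (Idl\<^bsub>mvpoly_ring X\<^esub> R) = card M - card (f ` M)"
proof -
  interpret cring "mvpoly_ring X :: ('x, 'k) mvpoly ring" by (rule cring_mvpoly_ring)
  let ?I = "Idl\<^bsub>mvpoly_ring X\<^esub> R"
  define rep where "rep t = inv_into M f (f t)" for t
  have rep: "rep t \<in> M" "f (rep t) = f t" if "t \<in> M" for t
    using that by (simp_all add: rep_def inv_into_into f_inv_into_f)
  have rep_eq: "rep t = rep u" if "f t = f u" for t u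
    using that by (simp add: rep_def)
  have rep_image: "rep ` M = inv_into M f ` f ` M"
    by (simp add: rep_def image_image)
  have "card (rep ` M) = card (f ` M)"
    unfolding rep_image by (intro card_image inj_on_inv_into) auto
  moreover have rep_sub: "rep ` M \<subseteq> M"
    using rep(1) by blast
  ultimately have card_N: "card (M - rep ` M) = card M - card (f ` M)"
    using fin by (simp add: card_Diff_subset finite_subset)
  define N where "N = M - rep ` M"
  have rep_N: "rep t \<notin> N" if "t \<in> M" for t
    using that by (simp add: N_def)
  define b :: "('x \<Rightarrow>\<^sub>0 nat) \<Rightarrow> ('x, 'k) mvpoly"
    where "b t = Poly_Mapping.single t 1 - Poly_Mapping.single (rep t) 1" for t
  have R_carrier: "p \<in> carrier (mvpoly_ring X)" "\<And>u. u \<in> Poly_Mapping.keys p \<Longrightarrow> d \<le> total_degree u"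
    if "p \<in> R" for p
  proof -
    have "Poly_Mapping.keys p \<subseteq> M"
      using that unfolding R_def by (auto dest!: subsetD[OF keys_diff] split: if_splits)
    then show "p \<in> carrier (mvpoly_ring X)" "\<And>u. u \<in> Poly_Mapping.keys p \<Longrightarrow> d \<le> total_degree u"
      using vars deg by auto
  qed
  have b_R: "b t \<in> R" if "t \<in> N" for t
  proof -
    have "t \<in> M" "rep t \<noteq> t"
      using that by (auto simp: N_def image_iff)
    then show ?thesis
      using rep[of t] unfolding R_def b_def by fastforce
  qed
  have lookup_b: "Poly_Mapping.lookup (b t) u = of_bool (u = t)" if "t \<in> N" "u \<in> N" for t u
    using that rep_N[of t] by (auto simp: b_def lookup_minus lookup_single when_def N_def image_iff)
  have I_eq: "Idl\<^bsub>mvpoly_ring X\<^esub> (b ` N) = ?I"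
  proof
    have RC: "R \<subseteq> carrier (mvpoly_ring X)"
      using R_carrier(1) by (rule subsetI)
    have "b ` N \<subseteq> R"
      using b_R by (rule image_subsetI)
    then show "Idl\<^bsub>mvpoly_ring X\<^esub> (b ` N) \<subseteq> ?I"
      using genideal_self[OF RC] by (intro genideal_minimal genideal_ideal[OF RC]) (rule subset_trans)
    have bN: "b ` N \<subseteq> carrier (mvpoly_ring X)"
      using \<open>b ` N \<subseteq> R\<close> RC by (rule subset_trans)
    interpret J: ideal "Idl\<^bsub>mvpoly_ring X\<^esub> (b ` N)" "mvpoly_ring X"
      using bN by (rule genideal_ideal)
    have b_J: "b t \<in> Idl\<^bsub>mvpoly_ring X\<^esub> (b ` N)" if "t \<in> M" for t
    proof (cases "t \<in> N")
      case True
      then show ?thesis using genideal_self[OF bN] by blast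
    next
      case False
      then obtain s where "s \<in> M" "t = rep s"
        using \<open>t \<in> M\<close> by (auto simp: N_def)
      then have "rep t = t"
        using rep rep_eq by metis
      then have "b t = \<zero>\<^bsub>mvpoly_ring X\<^esub>" by (simp add: b_def)
      then show ?thesis
        using J.zero_closed by metis
    qed
    show "?I \<subseteq> Idl\<^bsub>mvpoly_ring X\<^esub> (b ` N)"
    proof (rule genideal_minimal)
      show "R \<subseteq> Idl\<^bsub>mvpoly_ring X\<^esub> (b ` N)"
      proof
        fix p assume "p \<in> R"
        then obtain t u where tu: "p = Poly_Mapping.single t 1 - Poly_Mapping.single u 1"
          "t \<in> M" "u \<in> M" "f t = f u"
          unfolding R_def by blast
        have "p = b t \<ominus>\<^bsub>mvpoly_ring X\<^esub> b u"
          using rep_eq[OF tu(4)] b_J[OF tu(3)] J.a_subset a_inv_mvpoly_ring[of "b u" X]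
          by (auto simp: a_minus_def tu(1) b_def)
        then show "p \<in> Idl\<^bsub>mvpoly_ring X\<^esub> (b ` N)"
          using b_J tu(2,3) by (simp add: a_minus_def J.a_closed J.a_inv_closed del: mvpoly_ring_simps)
      qed
    qed (rule J.is_ideal)
  qed
  have lower: "card N \<le> card S"
    if S: "finite S" "S \<subseteq> carrier (mvpoly_ring X)" "Idl\<^bsub>mvpoly_ring X\<^esub> S = ?I"
    for S :: "('x, 'k) mvpoly set"
  proof (rule card_le_generators[OF S(1,2)])
    have "R \<subseteq> {p \<in> carrier (mvpoly_ring X). (\<forall>u\<in>Poly_Mapping.keys p. d \<le> total_degree u) \<and>
      coordinates {} p \<in> UNIV}"
      using R_carrier by blast
    \<comment> \<open>With no coordinates at all, only the bound on the degrees remains.\<close>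
    note genideal_minimal[OF ideal_lowest_degree[OF fun_space.subspace_UNIV] this]
    then show "d \<le> total_degree u" if "p \<in> S" "u \<in> Poly_Mapping.keys p" for p u
      using that S(3) genideal_self[OF S(2)] by blast
    show "total_degree t = d" if "t \<in> N" for t
      using that deg by (simp add: N_def)
    show "\<exists>p \<in> Idl\<^bsub>mvpoly_ring X\<^esub> S. \<forall>u\<in>N. Poly_Mapping.lookup p u = of_bool (u = t)"
      if "t \<in> N" for t
    proof (intro bexI ballI)
      show "b t \<in> Idl\<^bsub>mvpoly_ring X\<^esub> S"
        unfolding S(3) using b_R[OF that] R_carrier(1)
        by (intro subsetD[OF genideal_self] subsetI)
    qed (simp add: lookup_b that)
  qed
  have "inj_on b N"
  proof (rule inj_onI)
    fix s t assume st: "s \<in> N" "t \<in> N" "b s = b t"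
    have "of_bool (s = t) = (of_bool (s = s) :: 'k)"
      using lookup_b[OF st(2,1)] lookup_b[OF st(1,1)] st(3) by metis
    then show "s = t" by (simp split: if_splits)
  qed
  then have card_b: "card (b ` N) = card N"
    by (rule card_image)
  show ?thesis
    unfolding min_generators_def
  proof (rule Least_equality)
    show "\<exists>S\<subseteq>carrier (mvpoly_ring X). finite S \<and> card S = card M - card (f ` M) \<and>
        Idl\<^bsub>mvpoly_ring X\<^esub> S = ?I"
      using R_carrier(1) b_R fin card_b I_eq card_N
      by (intro exI[of _ "b ` N"]) (auto simp: N_def simp del: mvpoly_ring_simps(1))
  next
    fix k assume "\<exists>S\<subseteq>carrier (mvpoly_ring X). finite S \<and> card S = k \<and> Idl\<^bsub>mvpoly_ring X\<^esub> S = ?I"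
    then show "card M - card (f ` M) \<le> k"
      using lower card_N N_def by metis
  qed
qed

section \<open>Columns as increasing functions\<close>

definition column :: "nat set \<Rightarrow> tableau" where
  "column A = map (\<lambda>x. [x]) (sorted_list_of_set A)"

definition column_sets :: "nat \<Rightarrow> nat \<Rightarrow> nat set set" where
  "column_sets n m = {A. A \<subseteq> {1..m} \<and> A \<noteq> {} \<and> card A \<le> n}"

text \<open>The value \<open>\<infinity>\<close> below the last entry makes columns of different heights comparable: a missing entry is
larger than every entry, as the row inequalities of a semistandard tableau demand.\<close>

definition entry :: "nat set \<Rightarrow> nat \<Rightarrow> enat" where
  "entry A r = (if r < card A then enat (sorted_list_of_set A ! r) else \<infinity>)"

lemma column_sets_finite: "A \<in> column_sets n m \<Longrightarrow> finite A"
  using finite_subset[of A "{1..m}"] by (simp add: column_sets_def)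

lemma finite_column_sets: "finite (column_sets n m)"
  by (rule finite_subset[of _ "Pow {1..m}"]) (auto simp: column_sets_def)

lemma row_column:
  "row (column A) r = (if r < card A then [sorted_list_of_set A ! r] else [])"
  by (simp add: row_def column_def)

lemma entry_strict: "entry A r < entry A (Suc r) \<or> entry A (Suc r) = \<infinity>"
  using sorted_wrt_nth_less[OF strict_sorted_list_of_set[of A], of r "Suc r"]
  by (simp add: entry_def)

lemma entry_eq_enat_iff: "entry A r = enat x \<longleftrightarrow> r < card A \<and> sorted_list_of_set A ! r = x"
  by (simp add: entry_def)

lemma entry_range:
  assumes "finite A"
  shows "x \<in> A \<longleftrightarrow> (\<exists>r. entry A r = enat x)"
proof -
  have "x \<in> A \<longleftrightarrow> x \<in> set (sorted_list_of_set A)"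
    using assms by simp
  also have "\<dots> \<longleftrightarrow> (\<exists>r. entry A r = enat x)"
    unfolding in_set_conv_nth entry_eq_enat_iff by simp
  finally show ?thesis .
qed

lemma entry_inject:
  assumes "finite A" "finite B" "entry A = entry B"
  shows "A = B"
  using entry_range[OF assms(1)] entry_range[OF assms(2)] assms(3) by (simp add: set_eq_iff)

text \<open>The entries that are at most \<open>x\<close> fill the first rows of the column. This trades the row-wise
description of a column for the counting function \<open>x \<mapsto> card (A \<inter> {..x})\<close>, which is what the ballot
condition speaks about.\<close>

lemma entry_le_iff:
  assumes "finite A"
  shows "entry A r \<le> enat x \<longleftrightarrow> r < card (A \<inter> {..x})"
proof -
  let ?xs = "sorted_list_of_set A"
  let ?D = "{r. r < length ?xs \<and> ?xs ! r \<le> x}"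
  have "nth ?xs ` ?D = set ?xs \<inter> {..x}"
    by (auto simp: in_set_conv_nth simp del: set_sorted_list_of_set length_sorted_list_of_set)
  then have "nth ?xs ` ?D = A \<inter> {..x}"
    using assms by simp
  moreover have "inj_on (nth ?xs) ?D"
    by (intro inj_on_nth) auto
  ultimately have card: "card (A \<inter> {..x}) = card ?D"
    using card_image[of "nth ?xs" ?D] by simp
  have down: "s \<in> ?D" if "r \<in> ?D" "s \<le> r" for r s
  proof -
    have "?xs ! s \<le> ?xs ! r"
      using that by (intro sorted_nth_mono) simp_all
    then show ?thesis using that by simp
  qed
  have "\<exists>k. ?D = {..<k}"
  proof (cases "?D = {}")
    case False
    have "finite ?D" by simp
    then have "?D = {..<Suc (Max ?D)}"
      using down[OF Max_in[OF _ False]] Max_ge[of ?D]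
      by (intro equalityI subsetI) (simp_all only: lessThan_iff less_Suc_eq_le)
    then show ?thesis by blast
  qed (auto intro: exI[of _ 0])
  then obtain k where k: "?D = {..<k}" by blast
  then have "card ?D = k" by simp
  then have "r \<in> ?D \<longleftrightarrow> r < card (A \<inter> {..x})"
    using k card by simp
  then show ?thesis by (auto simp: entry_def)
qed

text \<open>Each of the two families of functions, rows to entries and bounds to cardinalities, inverts the other,
so the order is reversed.\<close>

lemma entry_le_entry_iff:
  assumes "finite A" "finite B"
  shows "entry A \<le> entry B \<longleftrightarrow> (\<forall>x. card (B \<inter> {..x}) \<le> card (A \<inter> {..x}))"
proof
  assume le: "entry A \<le> entry B"
  show "\<forall>x. card (B \<inter> {..x}) \<le> card (A \<inter> {..x})"
  proof (rule allI, rule ccontr)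
    fix x assume "\<not> card (B \<inter> {..x}) \<le> card (A \<inter> {..x})"
    then have "entry B (card (A \<inter> {..x})) \<le> enat x"
      by (simp add: entry_le_iff assms)
    then have "entry A (card (A \<inter> {..x})) \<le> enat x"
      using le order_trans by (auto simp: le_fun_def)
    then show False by (simp add: entry_le_iff assms)
  qed
next
  assume le: "\<forall>x. card (B \<inter> {..x}) \<le> card (A \<inter> {..x})"
  show "entry A \<le> entry B"
  proof (rule le_funI)
    fix r
    show "entry A r \<le> entry B r"
    proof (cases "entry B r")
      case (enat x)
      then have "r < card (B \<inter> {..x})"
        using entry_le_iff[OF assms(2), of r x] by simp
      then show ?thesis
        using le entry_le_iff[OF assms(1), of r x] enat by (metis less_le_trans)
    qed simp
  qed
qed

text \<open>The strictly increasing functions that eventually become \<open>\<infinity>\<close> are exactly the entry functions, which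
lets meets and joins of columns be formed pointwise.\<close>

lemma entry_surj:
  assumes strict: "\<And>r. e r < e (Suc r) \<or> e (Suc r) = \<infinity>" and top: "e h = \<infinity>"
  shows "\<exists>A. finite A \<and> entry A = e"
proof -
  define k where "k = (LEAST r. e r = \<infinity>)"
  have k: "e k = \<infinity>" and fin: "\<And>r. r < k \<Longrightarrow> e r \<noteq> \<infinity>"
    unfolding k_def using top by (auto intro: LeastI dest: not_less_Least)
  have inf: "e (k + r) = \<infinity>" for r
  proof (induction r)
    case (Suc r)
    then show ?case using strict[of "k + r"] by auto
  qed (simp add: k)
  define xs where "xs = map (\<lambda>r. the_enat (e r)) [0..<k]"
  have nth: "enat (xs ! r) = e r" if "r < k" for r
    using fin[OF that] that by (auto simp: xs_def)
  have "sorted_wrt (<) xs"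
  proof -
    have "xs ! r < xs ! Suc r" if "Suc r < k" for r
    proof -
      have "enat (xs ! r) < enat (xs ! Suc r)"
        using strict[of r] fin[OF that] that by (simp add: nth)
      then show ?thesis by simp
    qed
    then show ?thesis
      by (simp add: sorted_wrt_iff_nth_Suc_transp xs_def)
  qed
  then have "sorted_list_of_set (set xs) = xs" "card (set xs) = k"
    by (simp_all add: strict_sorted_iff sorted_list_of_set.idem_if_sorted_distinct distinct_card)
      (simp add: xs_def)
  then have "entry (set xs) = e"
    using nth inf by (auto simp: entry_def fun_eq_iff not_less le_iff_add)
  then show ?thesis by blast
qed

lemma column_sets_iff_entry:
  assumes "finite A"
  shows "A \<in> column_sets n m \<longleftrightarrow>
    entry A 0 \<noteq> \<infinity> \<and> entry A n = \<infinity> \<and> (\<forall>r x. entry A r = enat x \<longrightarrow> x \<in> {1..m})"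
proof -
  have "A \<noteq> {} \<longleftrightarrow> entry A 0 \<noteq> \<infinity>" "card A \<le> n \<longleftrightarrow> entry A n = \<infinity>"
    using assms by (auto simp: entry_def card_gt_0_iff)
  moreover have "A \<subseteq> {1..m} \<longleftrightarrow> (\<forall>r x. entry A r = enat x \<longrightarrow> x \<in> {1..m})"
    using entry_range[OF assms] by blast
  ultimately show ?thesis by (auto simp: column_sets_def)
qed

text \<open>Both the minimum and the maximum of two functions that increase strictly until they reach \<open>\<infinity>\<close>
behave in the same way, and they introduce no new values.\<close>

lemma column_sets_meet_join:
  assumes A: "A \<in> column_sets n m" and B: "B \<in> column_sets n m"
  shows "\<exists>C\<in>column_sets n m. entry C = inf (entry A) (entry B)"
    and "\<exists>C\<in>column_sets n m. entry C = sup (entry A) (entry B)"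
proof -
  have fin: "finite A" "finite B"
    using A B column_sets_finite by blast+
  note A' = A[unfolded column_sets_iff_entry[OF fin(1)]] and B' = B[unfolded column_sets_iff_entry[OF fin(2)]]
  have strict: "inf (entry A) (entry B) r < inf (entry A) (entry B) (Suc r) \<or> inf (entry A) (entry B) (Suc r) = \<infinity>"
    "sup (entry A) (entry B) r < sup (entry A) (entry B) (Suc r) \<or> sup (entry A) (entry B) (Suc r) = \<infinity>" for r
    using entry_strict[of A r] entry_strict[of B r]
    by (auto simp: inf_min sup_max min_def max_def)
  have top: "inf (entry A) (entry B) n = \<infinity>" "sup (entry A) (entry B) n = \<infinity>"
    using A' B' by (auto simp: inf_min sup_max)
  obtain C D where C: "finite C" "entry C = inf (entry A) (entry B)"
    and D: "finite D" "entry D = sup (entry A) (entry B)"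
    using entry_surj[OF strict(1) top(1)] entry_surj[OF strict(2) top(2)] by blast
  have "C \<in> column_sets n m"
    unfolding column_sets_iff_entry[OF C(1)] C(2) using A' B'
    by (auto simp: inf_min min_def split: if_splits)
  then show "\<exists>C\<in>column_sets n m. entry C = inf (entry A) (entry B)"
    using C by blast
  have "D \<in> column_sets n m"
    unfolding column_sets_iff_entry[OF D(1)] D(2) using A' B'
    by (auto simp: sup_max max_def split: if_splits)
  then show "\<exists>C\<in>column_sets n m. entry C = sup (entry A) (entry B)"
    using D by blast
qed

lemma inj_on_column: "inj_on column (column_sets n m)"
proof (rule inj_onI)
  fix A B assume AB: "A \<in> column_sets n m" "B \<in> column_sets n m" "column A = column B"
  have "inj (\<lambda>x :: nat. [x])" by (simp add: inj_def)
  then have "sorted_list_of_set A = sorted_list_of_set B"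
    using AB(3) by (simp add: column_def inj_map_eq_map)
  then show "A = B"
    using AB column_sets_finite sorted_list_of_set_inject by blast
qed

lemma inj_on_entry: "inj_on entry (column_sets n m)"
proof (rule inj_onI)
  fix A B assume AB: "A \<in> column_sets n m" "B \<in> column_sets n m" "entry A = entry B"
  then show "A = B"
    by (intro entry_inject[OF column_sets_finite column_sets_finite])
qed

lemma one_column_tableaux_eq: "one_column_tableaux n m = column ` column_sets n m"
proof (intro equalityI subsetI)
  fix T assume "T \<in> column ` column_sets n m"
  then obtain A where A: "A \<in> column_sets n m" "T = column A" by blast
  then have fin: "finite A" by (simp add: column_sets_finite)
  have in_A: "sorted_list_of_set A ! r \<in> A" if "r < card A" for r
    using that fin set_sorted_list_of_set[OF fin] length_sorted_list_of_set[of A] nth_mem by metis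
  have less: "sorted_list_of_set A ! r < sorted_list_of_set A ! Suc r" if "Suc r < card A" for r
    using sorted_wrt_nth_less[OF strict_sorted_list_of_set[of A], of r "Suc r"] that by simp
  have "semistandard T"
    unfolding semistandard_def A(2)
  proof (intro conjI allI ballI impI)
    show "[] \<notin> set (column A)" by (auto simp: column_def)
    fix r
    show "length (row (column A) (Suc r)) \<le> length (row (column A) r)" "sorted (row (column A) r)"
      by (simp_all add: row_column)
    show "row (column A) r ! c < row (column A) (Suc r) ! c" if "c < length (row (column A) (Suc r))" for c
      using that less[of r] by (simp add: row_column split: if_splits)
    show "1 \<le> x" if "x \<in> set (row (column A) r)" for x
      using that in_A[of r] A(1) by (auto simp: row_column column_sets_def split: if_splits)
  qed
  moreover have "length T \<le> n" "\<forall>R\<in>set T. set R \<subseteq> {1..m}" "length (row T 0) = 1"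
    using A fin by (auto simp: A(2) row_column, auto simp: column_def column_sets_def card_gt_0_iff)
  ultimately show "T \<in> one_column_tableaux n m"
    by (simp add: one_column_tableaux_def SSYT_def)
next
  fix T assume T: "T \<in> one_column_tableaux n m"
  then have ss: "semistandard T" by (simp add: one_column_tableaux_def SSYT_def)
  have len: "length (row T r) \<le> 1" for r
  proof (induction r)
    case 0
    then show ?case using T by (simp add: one_column_tableaux_def)
  next
    case (Suc r)
    then show ?case using ss order_trans unfolding semistandard_def by blast
  qed
  have single: "row T r = [hd (row T r)]" if "r < length T" for r
  proof -
    have "row T r \<noteq> []" using nth_mem[OF that] ss that by (metis row_def semistandard_def)
    then show ?thesis using len[of r] by (cases "row T r") auto
  qed
  define xs where "xs = map hd T"
  have T_eq: "T = map (\<lambda>x. [x]) xs"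
    using single by (intro nth_equalityI) (simp_all add: xs_def row_def)
  have "xs ! r < xs ! Suc r" if "Suc r < length xs" for r
  proof -
    have "row T r ! 0 < row T (Suc r) ! 0"
      using ss single[of "Suc r"] that
      by (metis length_greater_0_conv length_map list.distinct(1) semistandard_def xs_def)
    then show ?thesis using that by (simp add: T_eq row_def)
  qed
  then have "sorted_wrt (<) xs" by (simp add: sorted_wrt_iff_nth_Suc_transp)
  then have xs: "sorted_list_of_set (set xs) = xs" "distinct xs"
    by (simp_all add: strict_sorted_iff sorted_list_of_set.idem_if_sorted_distinct)
  have "set xs \<in> column_sets n m"
    using T xs(2) by (auto simp: column_sets_def one_column_tableaux_def SSYT_def T_eq row_def distinct_card split: if_splits)
  moreover have "T = column (set xs)"
    by (simp add: column_def xs T_eq)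
  ultimately show "T \<in> column ` column_sets n m" by blast
qed

section \<open>The star product of two columns\<close>

lemma star_commute: "T \<star> T' = T' \<star> T"
proof -
  have "sort (xs @ ys) = sort (ys @ xs)" for xs ys :: "nat list"
    by (intro properties_for_sort) (simp_all add: union_commute)
  then show ?thesis by (simp add: star_def max.commute)
qed

lemma row_star: "row (T \<star> T') r = sort (row T r @ row T' r)"
  by (auto simp: star_def row_def)

lemma row_star_column:
  "row (column A \<star> column B) r =
    map the_enat (filter (\<lambda>e. e \<noteq> \<infinity>) [inf (entry A) (entry B) r, sup (entry A) (entry B) r])"
  by (auto simp: row_star row_column entry_def inf_min sup_max)

text \<open>A sorted row with at most two entries carries the same information as their minimum and maximum, a
missing entry counting as \<open>\<infinity>\<close>.\<close>

lemma star_column_eq_iff: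
  "column A \<star> column B = column C \<star> column D \<longleftrightarrow>
    inf (entry A) (entry B) = inf (entry C) (entry D) \<and> sup (entry A) (entry B) = sup (entry C) (entry D)"
    (is "?L \<longleftrightarrow> ?R")
proof
  have unsort: "a = c \<and> b = d"
    if "map the_enat (filter (\<lambda>e. e \<noteq> \<infinity>) [a, b]) = map the_enat (filter (\<lambda>e. e \<noteq> \<infinity>) [c, d])"
      "a \<le> b" "c \<le> d" for a b c d
    using that by (cases a; cases b; cases c; cases d) auto
  assume ?L
  then have "inf (entry A) (entry B) r = inf (entry C) (entry D) r \<and>
      sup (entry A) (entry B) r = sup (entry C) (entry D) r" for r
    using row_star_column by (intro unsort) (metis, simp_all add: le_supI1)
  then show ?R by blast
next
  assume R: ?R
  have len: "r < max (card A) (card B) \<longleftrightarrow> inf (entry A) (entry B) r \<noteq> \<infinity>" for A B r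
    by (auto simp: entry_def inf_min min_def)
  have "r < max (card A) (card B) \<longleftrightarrow> r < max (card C) (card D)" for r
    unfolding len using R by simp
  then have "max (card A) (card B) = max (card C) (card D)"
    by (meson linorder_neqE_nat order_less_irrefl)
  then have length: "length (column A \<star> column B) = length (column C \<star> column D)"
    by (simp add: star_def column_def)
  show ?L
  proof (rule nth_equalityI[OF length])
    fix r assume "r < length (column A \<star> column B)"
    then show "(column A \<star> column B) ! r = (column C \<star> column D) ! r"
      using row_star_column[of A B r] row_star_column[of C D r] R length by (simp add: row_def)
  qed
qed

section \<open>Generators and incomparable pairs of columns\<close>

definition pair_monomial :: "'x \<Rightarrow> 'x \<Rightarrow> 'x \<Rightarrow>\<^sub>0 nat" where
  "pair_monomial x y = Poly_Mapping.single x 1 + Poly_Mapping.single y 1"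

lemma keys_pair_monomial: "Poly_Mapping.keys (pair_monomial x y) = {x, y}"
  by (auto simp: pair_monomial_def in_keys_iff lookup_add lookup_single when_def split: if_splits)

lemma pair_monomial_commute: "pair_monomial x y = pair_monomial y x"
  by (simp add: pair_monomial_def add.commute)

lemma pair_monomial_eq_iff:
  "pair_monomial x y = pair_monomial u v \<longleftrightarrow> x = u \<and> y = v \<or> x = v \<and> y = u"
proof
  assume "pair_monomial x y = pair_monomial u v"
  then have "{x, y} = {u, v}"
    using keys_pair_monomial by metis
  then show "x = u \<and> y = v \<or> x = v \<and> y = u"
    by (simp add: doubleton_eq_iff)
qed (auto simp: pair_monomial_commute)

lemma Var_times_Var: "Var x * Var y = (Poly_Mapping.single (pair_monomial x y) 1 :: ('x, 'k::comm_ring_1) mvpoly)"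
  by (simp add: Var_def pair_monomial_def mult_single)

definition incomparable_pairs :: "nat \<Rightarrow> nat \<Rightarrow> (nat set \<times> nat set) set" where
  "incomparable_pairs n m = {(A, B). A \<in> column_sets n m \<and> B \<in> column_sets n m \<and>
     \<not> entry A \<le> entry B \<and> \<not> entry B \<le> entry A}"

lemma finite_incomparable_pairs: "finite (incomparable_pairs n m)"
  by (rule finite_subset[of _ "column_sets n m \<times> column_sets n m"])
    (auto simp: incomparable_pairs_def finite_column_sets)

text \<open>In a linear order, one of two elements together with their minimum and maximum determines the other.\<close>

lemma star_cancel:
  assumes "{A, B, C} \<subseteq> column_sets n m" and "column A \<star> column B = column A \<star> column C"
  shows "B = C"
proof -
  have cancel: "b = c" if "min a b = min a c" "max a b = max a c" for a b c :: enat
    using that by (auto simp: min_def max_def split: if_splits)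
  have "inf (entry A) (entry B) r = inf (entry A) (entry C) r"
    "sup (entry A) (entry B) r = sup (entry A) (entry C) r" for r
    using assms(2) unfolding star_column_eq_iff by simp_all
  then have "entry B = entry C"
    unfolding inf_fun_def sup_fun_def inf_min sup_max using cancel by (intro ext) blast
  then show ?thesis
    using assms(1) by (intro inj_onD[OF inj_on_entry, of B C n m]) simp_all
qed

lemma star_square:
  assumes "{A, B, C} \<subseteq> column_sets n m" and "column A \<star> column A = column B \<star> column C"
  shows "A = B \<and> A = C"
proof -
  have "entry A = inf (entry B) (entry C)" "entry A = sup (entry B) (entry C)"
    using assms(2)[unfolded star_column_eq_iff] by (metis inf_idem, metis sup_idem)
  then have "entry A = entry B" "entry A = entry C"
    by (metis antisym inf_le1 sup_ge1, metis antisym inf_le2 sup_ge2)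
  then show ?thesis
    using assms(1) inj_onD[OF inj_on_entry, of A B n m] inj_onD[OF inj_on_entry, of A C n m] by simp
qed

text \<open>The distinctness required of the tableaux in a relation only excludes the trivial relations: two
distinct monomials with the same product share no factor, and neither of them is a square.\<close>

lemma distinct_if_star_eq:
  assumes sub: "{A, B, C, D} \<subseteq> column_sets n m"
    and eq: "column A \<star> column B = column C \<star> column D"
    and neq: "pair_monomial (column A) (column B) \<noteq> pair_monomial (column C) (column D)"
  shows "distinct [column A, column B, column C, column D]"
proof -
  have "A \<noteq> C"
    using star_cancel[of A B D n m] sub eq neq by auto
  moreover have "A \<noteq> D"
    using star_cancel[of A B C n m] sub eq neq star_commute[of "column C"] pair_monomial_commute[of "column C"] by auto
  moreover have "B \<noteq> C"
    using star_cancel[of B A D n m] sub eq neq star_commute[of "column A"] pair_monomial_commute[of "column A"] by auto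
  moreover have "B \<noteq> D"
    using star_cancel[of B A C n m] sub eq neq star_commute[of _ "column B"] pair_monomial_commute[of _ "column B"] by auto
  moreover have "A \<noteq> B"
    using star_square[of A C D n m] sub eq \<open>A \<noteq> C\<close> by auto
  moreover have "C \<noteq> D"
    using star_square[of C A B n m] sub eq \<open>A \<noteq> C\<close> by auto
  ultimately show ?thesis
    using sub inj_on_eq_iff[OF inj_on_column, of _ n m] by simp
qed

text \<open>The star product is commutative, so it is a function of the monomial. It is the map whose fibres define
the ideal.\<close>

definition star_of_monomial :: "(tableau \<Rightarrow>\<^sub>0 nat) \<Rightarrow> tableau" where
  "star_of_monomial t = (THE S. \<exists>T T'. t = pair_monomial T T' \<and> S = T \<star> T')"

lemma star_of_pair_monomial [simp]: "star_of_monomial (pair_monomial T T') = T \<star> T'"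
  unfolding star_of_monomial_def
  by (rule the_equality) (auto simp: pair_monomial_eq_iff star_commute)

definition quadratic_monomials :: "nat \<Rightarrow> nat \<Rightarrow> (tableau \<Rightarrow>\<^sub>0 nat) set" where
  "quadratic_monomials n m =
    (\<lambda>(A, B). pair_monomial (column A) (column B)) ` (column_sets n m \<times> column_sets n m)"

lemma star_relations_eq:
  "(star_relations n m :: (tableau, 'k::comm_ring_1) mvpoly set) =
    {Poly_Mapping.single t 1 - Poly_Mapping.single u 1 | t u.
      t \<in> quadratic_monomials n m \<and> u \<in> quadratic_monomials n m \<and> t \<noteq> u \<and>
      star_of_monomial t = star_of_monomial u}" (is "_ = ?R")
proof (intro equalityI subsetI)
  fix p :: "(tableau, 'k) mvpoly" assume "p \<in> star_relations n m"
  then obtain T1 T2 T3 T4 where p: "p = Var T1 * Var T2 - Var T3 * Var T4"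
    and T: "{T1, T2, T3, T4} \<subseteq> column ` column_sets n m" "distinct [T1, T2, T3, T4]" "T1 \<star> T2 = T3 \<star> T4"
    unfolding star_relations_def one_column_tableaux_eq by blast
  have "pair_monomial T1 T2 \<in> quadratic_monomials n m" "pair_monomial T3 T4 \<in> quadratic_monomials n m"
    using T(1) by (auto simp: quadratic_monomials_def)
  moreover have "pair_monomial T1 T2 \<noteq> pair_monomial T3 T4"
    using T(2) by (auto simp: pair_monomial_eq_iff)
  ultimately show "p \<in> ?R"
    unfolding p Var_times_Var using T(3) star_of_pair_monomial[of T1 T2] star_of_pair_monomial[of T3 T4]
    by fastforce
next
  fix p :: "(tableau, 'k) mvpoly" assume "p \<in> ?R"
  then obtain A B C D where p: "p = Var (column A) * Var (column B) - Var (column C) * Var (column D)"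
    and sub: "{A, B, C, D} \<subseteq> column_sets n m"
    and neq: "pair_monomial (column A) (column B) \<noteq> pair_monomial (column C) (column D)"
    and eq: "column A \<star> column B = column C \<star> column D"
    unfolding Var_times_Var quadratic_monomials_def by auto
  have "{column A, column B, column C, column D} \<subseteq> one_column_tableaux n m"
    using sub by (auto simp: one_column_tableaux_eq)
  then show "p \<in> star_relations n m"
    unfolding star_relations_def p using eq distinct_if_star_eq[OF sub eq neq] by blast
qed

lemma min_generators_star_ideal:
  "min_generators (mvpoly_ring (one_column_tableaux n m) :: (tableau, 'k::field) mvpoly ring) (star_ideal n m)
    = card (quadratic_monomials n m) - card (star_of_monomial ` quadratic_monomials n m)"
  unfolding star_ideal_def star_relations_eq
proof (rule min_generators_binomial_ideal)
  show "finite (quadratic_monomials n m)"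
    by (simp add: quadratic_monomials_def finite_column_sets)
  show "total_degree t = 2" if "t \<in> quadratic_monomials n m" for t
    using that by (auto simp: quadratic_monomials_def pair_monomial_def total_degree_add)
  show "Poly_Mapping.keys t \<subseteq> one_column_tableaux n m" if "t \<in> quadratic_monomials n m" for t
    using that by (auto simp: quadratic_monomials_def keys_pair_monomial one_column_tableaux_eq)
qed

text \<open>Replacing a pair of columns by its meet and join gives a comparable pair with the same product, and
a comparable pair can be recovered from its product as minimum and maximum.\<close>

lemma card_star_image:
  "card (star_of_monomial ` quadratic_monomials n m) =
    card {pair_monomial (column A) (column B) | A B.
      A \<in> column_sets n m \<and> B \<in> column_sets n m \<and> entry A \<le> entry B}" (is "_ = card ?S")
proof -
  have "star_of_monomial ` quadratic_monomials n m = star_of_monomial ` ?S"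
  proof (intro equalityI image_subsetI)
    fix t assume "t \<in> quadratic_monomials n m"
    then obtain A B where AB: "A \<in> column_sets n m" "B \<in> column_sets n m"
      "t = pair_monomial (column A) (column B)"
      by (auto simp: quadratic_monomials_def)
    obtain C D where C: "C \<in> column_sets n m" "entry C = inf (entry A) (entry B)"
      and D: "D \<in> column_sets n m" "entry D = sup (entry A) (entry B)"
      using column_sets_meet_join[OF AB(1,2)] by blast
    have le: "entry C \<le> entry D"
      unfolding C(2) D(2) by (simp add: le_supI1)
    then have "column A \<star> column B = column C \<star> column D"
      unfolding star_column_eq_iff using C(2) D(2) by (simp add: inf_absorb1 sup_absorb2)
    then have "star_of_monomial t = star_of_monomial (pair_monomial (column C) (column D))"
      by (simp add: AB(3))
    moreover have "pair_monomial (column C) (column D) \<in> ?S"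
      using C(1) D(1) le by blast
    ultimately show "star_of_monomial t \<in> star_of_monomial ` ?S"
      by (rule image_eqI)
  qed (auto simp: quadratic_monomials_def)
  moreover have "inj_on star_of_monomial ?S"
  proof (rule inj_onI)
    fix t u assume t: "t \<in> ?S" and u: "u \<in> ?S" and eq: "star_of_monomial t = star_of_monomial u"
    obtain A B where AB: "A \<in> column_sets n m" "B \<in> column_sets n m" "entry A \<le> entry B"
      "t = pair_monomial (column A) (column B)"
      using t by blast
    obtain C D where CD: "C \<in> column_sets n m" "D \<in> column_sets n m" "entry C \<le> entry D"
      "u = pair_monomial (column C) (column D)"
      using u by blast
    have "entry A = entry C" "entry B = entry D"
      using eq AB(3) CD(3) unfolding AB(4) CD(4) star_of_pair_monomial star_column_eq_iff
      by (simp_all add: inf_absorb1 sup_absorb2)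
    then show "t = u"
      using AB CD entry_inject column_sets_finite by metis
  qed
  ultimately show ?thesis by (simp add: card_image)
qed

text \<open>The monomials left over after removing those of comparable pairs come from incomparable pairs. Such
a pair has two different members, whence the factor two for the order.\<close>

lemma card_incomparable_pairs:
  "card (incomparable_pairs n m) =
    2 * (card (quadratic_monomials n m) - card (star_of_monomial ` quadratic_monomials n m))"
proof -
  let ?pm = "\<lambda>(A, B). pair_monomial (column A) (column B)"
  let ?S = "{pair_monomial (column A) (column B) | A B.
      A \<in> column_sets n m \<and> B \<in> column_sets n m \<and> entry A \<le> entry B}"
  have pm_eq: "pair_monomial (column A) (column B) = pair_monomial (column C) (column D) \<longleftrightarrow>
      A = C \<and> B = D \<or> A = D \<and> B = C" if "{A, B, C, D} \<subseteq> column_sets n m" for A B C D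
    using that inj_on_eq_iff[OF inj_on_column, of _ n m] by (simp add: pair_monomial_eq_iff)
  have "quadratic_monomials n m - ?S = ?pm ` incomparable_pairs n m"
  proof (intro equalityI subsetI)
    fix t assume t: "t \<in> quadratic_monomials n m - ?S"
    then obtain A B where AB: "A \<in> column_sets n m" "B \<in> column_sets n m"
      "t = pair_monomial (column A) (column B)"
      by (auto simp: quadratic_monomials_def)
    moreover have "\<not> entry A \<le> entry B" "\<not> entry B \<le> entry A"
      using t AB pair_monomial_commute[of "column A"] by blast+
    ultimately show "t \<in> ?pm ` incomparable_pairs n m"
      by (auto simp: incomparable_pairs_def)
  next
    fix t assume "t \<in> ?pm ` incomparable_pairs n m"
    then obtain A B where AB: "A \<in> column_sets n m" "B \<in> column_sets n m"
      "\<not> entry A \<le> entry B" "\<not> entry B \<le> entry A" "t = pair_monomial (column A) (column B)"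
      by (auto simp: incomparable_pairs_def)
    have "t \<notin> ?S"
    proof
      assume "t \<in> ?S"
      then obtain C D where "C \<in> column_sets n m" "D \<in> column_sets n m" "entry C \<le> entry D"
        "t = pair_monomial (column C) (column D)"
        by blast
      then show False
        using AB pm_eq[of A B C D] by auto
    qed
    then show "t \<in> quadratic_monomials n m - ?S"
      using AB by (auto simp: quadratic_monomials_def)
  qed
  moreover have S: "?S \<subseteq> quadratic_monomials n m"
    by (auto simp: quadratic_monomials_def)
  moreover have "finite (quadratic_monomials n m)"
    by (simp add: quadratic_monomials_def finite_column_sets)
  ultimately have card_image: "card (?pm ` incomparable_pairs n m) =
      card (quadratic_monomials n m) - card (star_of_monomial ` quadratic_monomials n m)"
    using card_Diff_subset[OF finite_subset[OF S] S] by (simp add: card_star_image)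
  have fibre: "card {P \<in> incomparable_pairs n m. ?pm P = t} = 2"
    if "t \<in> ?pm ` incomparable_pairs n m" for t
  proof -
    from that obtain P where "P \<in> incomparable_pairs n m" "t = ?pm P"
      by blast
    then obtain A B where AB: "(A, B) \<in> incomparable_pairs n m" "t = pair_monomial (column A) (column B)"
      by (cases P) simp
    have "{P \<in> incomparable_pairs n m. ?pm P = t} = {(A, B), (B, A)}"
      using AB pm_eq by (auto simp: incomparable_pairs_def)
    moreover have "A \<noteq> B"
      using AB(1) by (auto simp: incomparable_pairs_def)
    ultimately show ?thesis by simp
  qed
  have "card (incomparable_pairs n m) =
      (\<Sum>t\<in>?pm ` incomparable_pairs n m. card {P \<in> incomparable_pairs n m. ?pm P = t})"
    using sum.image_gen[OF finite_incomparable_pairs, of "\<lambda>_. 1 :: nat" n m ?pm] by simp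
  also have "\<dots> = 2 * card (?pm ` incomparable_pairs n m)"
    by (simp add: fibre)
  finally show ?thesis by (simp only: card_image)
qed

section \<open>Ballot subsets\<close>

text \<open>Read the elements of \<open>U\<close> in increasing order as votes, those in \<open>B\<close> for one candidate and those in
\<open>U - B\<close> for the other. The condition says that the candidate of \<open>B\<close> is never strictly ahead.\<close>

definition ballot_subset :: "nat set \<Rightarrow> nat set \<Rightarrow> bool" where
  "ballot_subset U B \<longleftrightarrow> B \<subseteq> U \<and> (\<forall>x. 2 * card (B \<inter> {..x}) \<le> card (U \<inter> {..x}))"

text \<open>A new last vote can violate the condition only at the very end of the count.\<close>

lemma ballot_subset_insert_max:
  assumes U: "finite U" "\<And>u. u \<in> U \<Longrightarrow> u < b" and B: "B \<subseteq> U"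
  shows "ballot_subset (insert b U) B \<longleftrightarrow> ballot_subset U B"
    and "ballot_subset (insert b U) (insert b B) \<longleftrightarrow> ballot_subset U B \<and> 2 * card B < card U"
proof -
  have b: "b \<notin> U" "b \<notin> B" using assms by blast+
  have low: "V \<inter> {..x} = V" if "V \<subseteq> U" "x \<ge> b" for V x
    using that U(2) by fastforce
  have ins: "card (insert b V \<inter> {..x}) = (if b \<le> x then Suc (card V) else card (V \<inter> {..x}))"
    if "V \<subseteq> U" for V x
  proof -
    have "finite V" "b \<notin> V" using that U(1) b finite_subset by blast+
    then show ?thesis using low[OF that] by simp
  qed
  have split: "ballot_subset W C \<longleftrightarrow> C \<subseteq> W \<and>
      (\<forall>x<b. 2 * card (C \<inter> {..x}) \<le> card (W \<inter> {..x})) \<and>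
      (\<forall>x\<ge>b. 2 * card (C \<inter> {..x}) \<le> card (W \<inter> {..x}))" for W C
    unfolding ballot_subset_def by (meson not_le)
  \<comment> \<open>The bounds below \<open>b\<close> include the final count in \<open>U\<close>, at \<open>b - 1\<close>.\<close>
  have B_le: "2 * card B \<le> card U"
    if "\<forall>x<b. 2 * card (B \<inter> {..x}) \<le> card (U \<inter> {..x})"
  proof (cases b)
    case 0
    then have "U = {}" using U(2) by blast
    then show ?thesis using B by simp
  next
    case (Suc y)
    then have "U \<inter> {..y} = U" "B \<inter> {..y} = B"
      using U(2) B by fastforce+
    then show ?thesis using that Suc by (metis lessI)
  qed
  have U_iff: "ballot_subset U B \<longleftrightarrow>
      (\<forall>x<b. 2 * card (B \<inter> {..x}) \<le> card (U \<inter> {..x}))" (is "_ \<longleftrightarrow> ?low")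
    unfolding split using B low[OF B] low[OF order_refl] B_le by auto
  have W_low: "(\<forall>x<b. 2 * card (V \<inter> {..x}) \<le> card (insert b U \<inter> {..x})) \<longleftrightarrow>
      (\<forall>x<b. 2 * card (V \<inter> {..x}) \<le> card (U \<inter> {..x}))" for V
    by (simp add: ins)
  show "ballot_subset (insert b U) B \<longleftrightarrow> ballot_subset U B"
  proof -
    have "(\<forall>x\<ge>b. 2 * card (B \<inter> {..x}) \<le> card (insert b U \<inter> {..x})) \<longleftrightarrow> 2 * card B \<le> Suc (card U)"
      by (metis low[OF B] ins[OF order_refl] order_refl)
    then show ?thesis
      unfolding split[of "insert b U"] U_iff W_low using B B_le by auto
  qed
  show "ballot_subset (insert b U) (insert b B) \<longleftrightarrow> ballot_subset U B \<and> 2 * card B < card U"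
  proof -
    have "(\<forall>x\<ge>b. 2 * card (insert b B \<inter> {..x}) \<le> card (insert b U \<inter> {..x})) \<longleftrightarrow>
        2 * Suc (card B) \<le> Suc (card U)"
      by (metis ins[OF B] ins[OF order_refl] order_refl)
    moreover have "(\<forall>x<b. 2 * card (insert b B \<inter> {..x}) \<le> card (U \<inter> {..x})) \<longleftrightarrow> ?low"
      by (simp add: ins[OF B])
    ultimately show ?thesis
      unfolding split[of "insert b U"] U_iff W_low using B by auto
  qed
qed

text \<open>Deciding about the largest element of \<open>U\<close> gives Pascal's recurrence on both sides. The hypothesis
admits \<open>2 * p = Suc (card U)\<close>, where there is no ballot subset and both binomial coefficients agree;
this boundary case is what the recurrence falls back on when the votes are tied.\<close>

lemma ballot_theorem:
  fixes U :: "nat set"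
  assumes "finite U" and "2 * p \<le> Suc (card U)"
  shows "card {B. ballot_subset U B \<and> card B = p} + (if p = 0 then 0 else card U choose (p - 1))
    = card U choose p"
  using assms
proof (induction U arbitrary: p rule: finite_linorder_max_induct)
  case empty
  then have "p = 0" by simp
  moreover have "{B. ballot_subset {} B \<and> card B = 0} = {{}}"
    by (auto simp: ballot_subset_def)
  ultimately show ?case by simp
next
  case (insert b U)
  let ?G = "\<lambda>U p. {B. ballot_subset U B \<and> card B = p}"
  have fin: "finite (?G U p)" for p
    by (rule finite_subset[of _ "Pow U"]) (auto simp: ballot_subset_def insert.hyps(1))
  have b: "b \<notin> U" using insert.hyps(2) by blast
  show ?case
  proof (cases p)
    case 0
    have "?G (insert b U) 0 = {{}}"
      by (auto simp: ballot_subset_def card_eq_0_iff dest: finite_subset[OF _ finite.insertI[OF insert.hyps(1)]])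
    then show ?thesis using 0 by simp
  next
    case (Suc q)
    show ?thesis
    proof (cases "2 * p \<le> Suc (card U)")
      case True
      have "?G (insert b U) p = ?G U p \<union> insert b ` ?G U q"
      proof (intro equalityI subsetI)
        fix B assume B: "B \<in> ?G (insert b U) p"
        then have sub: "B - {b} \<subseteq> U" by (auto simp: ballot_subset_def)
        then have fB: "finite (B - {b})" using insert.hyps(1) finite_subset by blast
        show "B \<in> ?G U p \<union> insert b ` ?G U q"
        proof (cases "b \<in> B")
          case True
          then have eq: "insert b (B - {b}) = B" by blast
          then have "ballot_subset U (B - {b})" "card (B - {b}) = q"
            using ballot_subset_insert_max(2)[OF insert.hyps(1) _ sub, of b] insert.hyps(2) B Suc True
            by simp_all
          then show ?thesis using eq by blast
        next
          case False
          then show ?thesis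
            using ballot_subset_insert_max(1)[OF insert.hyps(1) _ sub, of b] insert.hyps(2) B by simp
        qed
      next
        fix B assume "B \<in> ?G U p \<union> insert b ` ?G U q"
        then show "B \<in> ?G (insert b U) p"
        proof
          assume "B \<in> ?G U p"
          then show ?thesis
            using ballot_subset_insert_max(1)[OF insert.hyps(1), of b B] insert.hyps(2)
            by (simp add: ballot_subset_def)
        next
          assume "B \<in> insert b ` ?G U q"
          then obtain C where C: "B = insert b C" "ballot_subset U C" "card C = q" by blast
          then have sub: "C \<subseteq> U" by (simp add: ballot_subset_def)
          then have "finite C" "b \<notin> C" using insert.hyps(1) b finite_subset by blast+
          moreover have "2 * card C < card U" using C Suc True by simp
          ultimately show ?thesis
            using ballot_subset_insert_max(2)[OF insert.hyps(1) _ sub, of b] insert.hyps(2) C Suc by simp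
        qed
      qed
      moreover have "?G U p \<inter> insert b ` ?G U q = {}"
        using b by (auto simp: ballot_subset_def)
      moreover have "inj_on (insert b) (?G U q)"
        using b by (intro inj_onI) (auto simp: ballot_subset_def dest: insert_ident[THEN iffD1, rotated 2])
      ultimately have "card (?G (insert b U) p) = card (?G U p) + card (?G U q)"
        using fin by (simp add: card_Un_disjoint card_image)
      moreover have "card (?G U p) + (card U choose q) = card U choose p"
        using insert.IH[of p] True Suc by simp
      moreover have "card (?G U q) + (if q = 0 then 0 else card U choose (q - 1)) = card U choose q"
        using insert.IH[of q] True Suc by simp
      moreover have "Suc (card U) choose q = (card U choose q) + (if q = 0 then 0 else card U choose (q - 1))"
        by (cases q) simp_all
      ultimately show ?thesis
        using Suc b insert.hyps(1) by simp
    next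
      case False
      then have p: "card (insert b U) = 2 * q + 1"
        using insert.prems Suc b insert.hyps(1) by simp
      have "?G (insert b U) p = {}"
      proof -
        have False if B: "ballot_subset (insert b U) B" "card B = p" for B
        proof -
          have sub: "B \<subseteq> insert b U" using B by (simp add: ballot_subset_def)
          have "V \<inter> {..b} = V" if "V \<subseteq> insert b U" for V
            using that insert.hyps(2) by fastforce
          then have "2 * card B \<le> card (insert b U)"
            using B sub unfolding ballot_subset_def by (metis order_refl)
          then show False using p B(2) Suc by simp
        qed
        then show ?thesis by blast
      qed
      \<comment> \<open>The two middle binomial coefficients agree, so the formula gives zero as well.\<close>
      moreover have "(2 * q + 1) choose q = (2 * q + 1) choose Suc q"
        using binomial_symmetric[of q "2 * q + 1"] by simp
      ultimately show ?thesis
        by (simp only: p Suc) simp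
    qed
  qed
qed

section \<open>Counting incomparable pairs\<close>

text \<open>Common elements contribute equally to the counting functions of \<open>A\<close> and \<open>B\<close> and cancel.\<close>

lemma entry_le_iff_ballot:
  assumes "finite A" "finite B"
  shows "entry A \<le> entry B \<longleftrightarrow> ballot_subset ((A - B) \<union> (B - A)) (B - A)"
proof -
  have split: "card (V \<union> W) = card V + card W" if "V \<inter> W = {}" "finite V" "finite W" for V W :: "nat set"
    using that by (simp add: card_Un_disjoint)
  have "card (B \<inter> {..x}) \<le> card (A \<inter> {..x}) \<longleftrightarrow>
      2 * card ((B - A) \<inter> {..x}) \<le> card (((A - B) \<union> (B - A)) \<inter> {..x})" for x
  proof -
    have "card (A \<inter> {..x}) = card (A \<inter> B \<inter> {..x}) + card ((A - B) \<inter> {..x})"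
      using assms by (subst split[symmetric]) (auto intro!: arg_cong[of _ _ card])
    moreover have "card (B \<inter> {..x}) = card (A \<inter> B \<inter> {..x}) + card ((B - A) \<inter> {..x})"
      using assms by (subst split[symmetric]) (auto intro!: arg_cong[of _ _ card])
    moreover have "card (((A - B) \<union> (B - A)) \<inter> {..x}) = card ((A - B) \<inter> {..x}) + card ((B - A) \<inter> {..x})"
      using assms by (subst split[symmetric]) (auto intro!: arg_cong[of _ _ card])
    ultimately show ?thesis by linarith
  qed
  then show ?thesis
    by (simp add: entry_le_entry_iff[OF assms] ballot_subset_def)
qed

text \<open>With \<open>U\<close> the symmetric difference of two columns and \<open>B\<close> the part belonging to one of them, these are
the incomparable configurations.\<close>

definition unbalanced_subsets :: "nat set \<Rightarrow> nat \<Rightarrow> nat set set" where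
  "unbalanced_subsets U p = {B. B \<subseteq> U \<and> card B = p \<and> \<not> ballot_subset U B \<and> \<not> ballot_subset U (U - B)}"

lemma binomial_pred:
  assumes "0 < p"
  shows "(n + 1 - p) * (n choose (p - 1)) = p * (n choose p)"
proof (cases p)
  case (Suc q)
  have "Suc q * (n choose Suc q) = (n - q) * (n choose q)"
    by (simp only: binomial_absorption binomial_absorb_comp)
  then show ?thesis using Suc by simp
qed (use assms in simp)

lemma ballot_subset_card_le:
  assumes "finite U" "ballot_subset U B"
  shows "2 * card B \<le> card U"
proof -
  have "U \<inter> {..Max U} = U" "B \<inter> {..Max U} = B"
    using assms by (auto simp: ballot_subset_def)
  then show ?thesis
    using assms(2) unfolding ballot_subset_def by metis
qed

text \<open>The first vote goes to one of the two candidates, who is then ahead.\<close>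

lemma not_both_ballot_subsets:
  assumes "finite U" "U \<noteq> {}" "ballot_subset U B" "ballot_subset U (U - B)"
  shows False
proof -
  \<comment> \<open>Up to the minimum of \<open>U\<close> there is a single vote.\<close>
  let ?x = "Min U"
  have "U \<inter> {..?x} = {?x}"
    using Min_in[OF assms(1,2)] assms(1) by (auto intro: antisym)
  then have "2 * card (B \<inter> {..?x}) \<le> 1" "2 * card ((U - B) \<inter> {..?x}) \<le> 1"
    using assms(3,4) unfolding ballot_subset_def by (metis is_singletonI is_singleton_altdef)+
  then have "card (B \<inter> {..?x}) = 0" "card ((U - B) \<inter> {..?x}) = 0"
    by linarith+
  moreover have "finite (B \<inter> {..?x})" "finite ((U - B) \<inter> {..?x})" by simp_all
  ultimately have "B \<inter> {..?x} = {}" "(U - B) \<inter> {..?x} = {}"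
    by (simp_all only: card_0_eq)
  moreover have "?x \<in> U" using assms(1,2) by simp
  ultimately show False by blast
qed

text \<open>If \<open>j > 0\<close>, the complement of \<open>B\<close> has more than half of the elements and is never a ballot subset, so the
ballot theorem leaves \<open>N choose (p - 1)\<close> subsets, where \<open>N = 2 * p + j\<close>. If \<open>j = 0\<close>, complementation
exchanges the two forbidden conditions, which exclude each other, and their common number is subtracted
twice.\<close>

lemma card_unbalanced_subsets:
  assumes U: "finite U" "card U = 2 * p + j" and p: "0 < p"
  shows "real (card (unbalanced_subsets U p)) =
    (real p - of_bool (j = 0)) / (real p + real j + 1) * real ((2 * p + j) choose p)"
proof -
  let ?N = "2 * p + j"
  let ?all = "{B. B \<subseteq> U \<and> card B = p}"
  let ?G = "{B. ballot_subset U B \<and> card B = p}"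
  let ?H = "{B \<in> ?all. ballot_subset U (U - B)}"
  have fin: "finite ?all" using U(1) by simp
  have sub: "?G \<subseteq> ?all" by (auto simp: ballot_subset_def)
  have all: "card ?all = ?N choose p" using U by (simp add: n_subsets)
  have good: "card ?G + (?N choose (p - 1)) = ?N choose p"
    using ballot_theorem[OF U(1), of p] U(2) p by simp
  have "(?N + 1 - p) * (?N choose (p - 1)) = p * (?N choose p)"
    using binomial_pred[OF p, of ?N] by simp
  moreover have nat_eq: "?N + 1 - p = p + j + 1" by simp
  ultimately have "real (p + j + 1) * real (?N choose (p - 1)) = real p * real (?N choose p)"
    by (metis of_nat_mult nat_eq)
  then have pred: "real (?N choose (p - 1)) = real p / (real p + real j + 1) * real (?N choose p)"
    by (simp add: field_simps)
  have unb: "unbalanced_subsets U p = ?all - (?G \<union> ?H)"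
    by (auto simp: unbalanced_subsets_def)
  show ?thesis
  proof (cases "j = 0")
    case False
    have "?H = {}"
    proof -
      have "\<not> ballot_subset U (U - B)" if "B \<in> ?all" for B
      proof
        assume "ballot_subset U (U - B)"
        then have "2 * card (U - B) \<le> card U"
          by (rule ballot_subset_card_le[OF U(1)])
        moreover have "card (U - B) = p + j"
          using that U finite_subset[of B U] by (simp add: card_Diff_subset)
        ultimately show False using False U(2) by simp
      qed
      then show ?thesis by blast
    qed
    then have "unbalanced_subsets U p = ?all - ?G"
      using unb by (simp only: Un_empty_right)
    then have "card (unbalanced_subsets U p) = card ?all - card ?G"
      using card_Diff_subset[OF finite_subset[OF sub fin] sub] by simp
    then have "card (unbalanced_subsets U p) = ?N choose (p - 1)"
      using all good by simp
    then show ?thesis using False pred by simp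
  next
    case True
    have "bij_betw (\<lambda>B. U - B) ?G ?H"
      using U True by (intro bij_betwI[where g = "\<lambda>B. U - B"])
        (auto simp: ballot_subset_def card_Diff_subset finite_subset double_diff)
    then have "card ?H = card ?G"
      by (simp add: bij_betw_same_card)
    moreover have "U \<noteq> {}" using U(2) p by auto
    then have "?G \<inter> ?H = {}"
      using not_both_ballot_subsets[OF U(1)] by blast
    moreover have "?G \<union> ?H \<subseteq> ?all" using sub by blast
    ultimately have "card (unbalanced_subsets U p) = card ?all - 2 * card ?G" "2 * card ?G \<le> card ?all"
      unfolding unb using fin sub card_mono[OF fin, of "?G \<union> ?H"]
      by (simp_all add: card_Diff_subset finite_subset card_Un_disjoint)
    then have "real (card (unbalanced_subsets U p)) = 2 * real (?N choose (p - 1)) - real (?N choose p)"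
      using all good by simp
    also have "\<dots> = (real p - 1) / (real p + real j + 1) * real (?N choose p)"
      unfolding pred using True by (simp add: field_simps)
    finally show ?thesis using True by simp
  qed
qed

definition incomparable_pairs_shape :: "nat \<Rightarrow> nat \<Rightarrow> nat \<Rightarrow> nat \<Rightarrow> (nat set \<times> nat set) set" where
  "incomparable_pairs_shape m i k j = {(A, B). A \<subseteq> {1..m} \<and> B \<subseteq> {1..m} \<and>
     card A = i + j \<and> card B = i \<and> card (A \<inter> B) = k \<and> \<not> entry A \<le> entry B \<and> \<not> entry B \<le> entry A}"

text \<open>A pair \<open>(A, B)\<close> amounts to the choice of \<open>K = A \<inter> B\<close>, of the symmetric difference \<open>U\<close> outside \<open>K\<close>,
and of \<open>B - A\<close> inside \<open>U\<close>; the three choices give the three binomial coefficients. Since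
\<open>card U = 2 * i + j - 2 * k\<close>, the result vanishes when \<open>U\<close> does not fit.\<close>

lemma card_incomparable_pairs_shape:
  assumes "k < i"
  shows "real (card (incomparable_pairs_shape m i k j)) = real (m choose k) *
    ((real i - real k - of_bool (j = 0)) / (real i + real j - real k + 1)) *
    real ((m - k) choose (2 * i + j - 2 * k)) * real ((2 * i + j - 2 * k) choose (i - k))"
proof -
  define p where "p = i - k"
  have i: "i = k + p" "0 < p" using assms by (simp_all add: p_def)
  let ?N = "2 * p + j"
  let ?T = "SIGMA K:{K. K \<subseteq> {1..m} \<and> card K = k}. SIGMA U:{U. U \<subseteq> {1..m} - K \<and> card U = ?N}.
    unbalanced_subsets U p"
  let ?f = "\<lambda>(A, B). (A \<inter> B, (A - B) \<union> (B - A), B - A)"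
  let ?g = "\<lambda>(K, U, C). (K \<union> (U - C), K \<union> C)"
  have fin: "finite A" if "A \<subseteq> {1..m}" for A
    using that by (rule finite_subset) simp
  have "bij_betw ?f (incomparable_pairs_shape m i k j) ?T"
  proof (rule bij_betwI[where g = ?g])
    show "?f \<in> incomparable_pairs_shape m i k j \<rightarrow> ?T"
    proof (rule funcsetI)
      fix P assume "P \<in> incomparable_pairs_shape m i k j"
      then obtain A B where P: "P = (A, B)" and AB: "A \<subseteq> {1..m}" "B \<subseteq> {1..m}"
        "card A = i + j" "card B = i" "card (A \<inter> B) = k"
        and inc: "\<not> entry A \<le> entry B" "\<not> entry B \<le> entry A"
        by (auto simp: incomparable_pairs_shape_def)
      note f = fin[OF AB(1)] fin[OF AB(2)]
      have diff: "card (A - B) = p + j" "card (B - A) = p"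
        using AB i f card_Diff_subset_Int[of A B] card_Diff_subset_Int[of B A] by (simp_all add: Int_commute)
      have U: "(A - B) \<union> (B - A) - (B - A) = A - B" by blast
      have "\<not> ballot_subset ((A - B) \<union> (B - A)) (B - A)"
        "\<not> ballot_subset ((A - B) \<union> (B - A)) (A - B)"
        using inc entry_le_iff_ballot[OF f] entry_le_iff_ballot[OF f(2,1)] Un_commute by metis+
      then have "B - A \<in> unbalanced_subsets ((A - B) \<union> (B - A)) p"
        unfolding unbalanced_subsets_def mem_Collect_eq U using diff(2) by blast
      moreover have "card ((A - B) \<union> (B - A)) = ?N"
        using diff f by (subst card_Un_disjoint) auto
      ultimately show "?f P \<in> ?T"
        using AB P by auto
    qed
    show "?g \<in> ?T \<rightarrow> incomparable_pairs_shape m i k j"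
    proof (rule funcsetI)
      fix Q assume "Q \<in> ?T"
      then obtain K U C where Q: "Q = (K, U, C)" and K: "K \<subseteq> {1..m}" "card K = k"
        and U: "U \<subseteq> {1..m} - K" "card U = ?N" and C: "C \<in> unbalanced_subsets U p"
        by auto
      have C': "C \<subseteq> U" "card C = p" "\<not> ballot_subset U C" "\<not> ballot_subset U (U - C)"
        using C by (simp_all add: unbalanced_subsets_def)
      let ?A = "K \<union> (U - C)" and ?B = "K \<union> C"
      have f: "finite K" "finite U" "finite C"
        using fin[OF K(1)] finite_subset[OF U(1)] finite_subset[OF C'(1)] by simp_all
      have sub: "?A \<subseteq> {1..m}" "?B \<subseteq> {1..m}" using K U C' by blast+
      have "card ?A = i + j" "card ?B = i"
      proof -
        have "card (U - C) = p + j" using C' U(2) f by (simp add: card_Diff_subset)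
        moreover have "K \<inter> (U - C) = {}" "K \<inter> C = {}" using U C' by blast+
        ultimately show "card ?A = i + j" "card ?B = i"
          using f K C' i by (simp_all add: card_Un_disjoint)
      qed
      moreover have "?A \<inter> ?B = K" using U C' by blast
      moreover have d: "?A - ?B = U - C" "?B - ?A = C" "(U - C) \<union> C = U" "C \<union> (U - C) = U"
        using U C' by blast+
      have "\<not> entry ?A \<le> entry ?B" "\<not> entry ?B \<le> entry ?A"
        unfolding entry_le_iff_ballot[OF fin[OF sub(1)] fin[OF sub(2)]]
          entry_le_iff_ballot[OF fin[OF sub(2)] fin[OF sub(1)]] d
        by (fact C')+
      ultimately show "?g Q \<in> incomparable_pairs_shape m i k j"
        using sub K Q by (simp add: incomparable_pairs_shape_def)
    qed
    show "?g (?f P) = P" if "P \<in> incomparable_pairs_shape m i k j" for P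
      by (cases P) auto
    show "?f (?g Q) = Q" if "Q \<in> ?T" for Q
      using that by (auto simp: unbalanced_subsets_def)
  qed
  then have "card (incomparable_pairs_shape m i k j) = card ?T"
    by (rule bij_betw_same_card)
  also have "\<dots> = (\<Sum>K | K \<subseteq> {1..m} \<and> card K = k. \<Sum>U | U \<subseteq> {1..m} - K \<and> card U = ?N.
      card (unbalanced_subsets U p))"
  proof -
    have fU: "finite (unbalanced_subsets U p)" if "U \<subseteq> {1..m} - K" for U K
    proof -
      have "finite U" using finite_subset[OF that] by simp
      show ?thesis
        by (rule finite_subset[of _ "Pow U"]) (auto simp: unbalanced_subsets_def \<open>finite U\<close>)
    qed
    have fS: "finite {U. U \<subseteq> V \<and> card U = l}" if "finite V" for V :: "nat set" and l
      by (rule finite_subset[of _ "Pow V"]) (use that in auto)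
    have inner: "finite (SIGMA U:{U. U \<subseteq> {1..m} - K \<and> card U = ?N}. unbalanced_subsets U p)"
      "card (SIGMA U:{U. U \<subseteq> {1..m} - K \<and> card U = ?N}. unbalanced_subsets U p) =
        (\<Sum>U | U \<subseteq> {1..m} - K \<and> card U = ?N. card (unbalanced_subsets U p))" for K
    proof -
      have *: "\<forall>U\<in>{U. U \<subseteq> {1..m} - K \<and> card U = ?N}. finite (unbalanced_subsets U p)"
        using fU by blast
      show "finite (SIGMA U:{U. U \<subseteq> {1..m} - K \<and> card U = ?N}. unbalanced_subsets U p)"
        using * by (intro finite_SigmaI fS) simp_all
      show "card (SIGMA U:{U. U \<subseteq> {1..m} - K \<and> card U = ?N}. unbalanced_subsets U p) =
        (\<Sum>U | U \<subseteq> {1..m} - K \<and> card U = ?N. card (unbalanced_subsets U p))"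
        using * by (intro card_SigmaI fS) simp_all
    qed
    have "card ?T = (\<Sum>K | K \<subseteq> {1..m} \<and> card K = k.
        card (SIGMA U:{U. U \<subseteq> {1..m} - K \<and> card U = ?N}. unbalanced_subsets U p))"
      using inner(1) by (intro card_SigmaI fS) simp_all
    then show ?thesis by (simp only: inner(2))
  qed
  finally have "real (card (incomparable_pairs_shape m i k j)) =
      (\<Sum>K | K \<subseteq> {1..m} \<and> card K = k. \<Sum>U | U \<subseteq> {1..m} - K \<and> card U = ?N.
        real (card (unbalanced_subsets U p)))" by simp
  also have "\<dots> = (\<Sum>K | K \<subseteq> {1..m} \<and> card K = k. \<Sum>U | U \<subseteq> {1..m} - K \<and> card U = ?N.
      (real p - of_bool (j = 0)) / (real p + real j + 1) * real (?N choose p))"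
  proof (intro sum.cong refl)
    fix K U assume "U \<in> {U. U \<subseteq> {1..m} - K \<and> card U = ?N}"
    then show "real (card (unbalanced_subsets U p)) =
        (real p - of_bool (j = 0)) / (real p + real j + 1) * real (?N choose p)"
      using finite_subset[of U "{1..m} - K"] i(2) by (intro card_unbalanced_subsets) auto
  qed
  also have "\<dots> = (\<Sum>K | K \<subseteq> {1..m} \<and> card K = k. real ((m - k) choose ?N) *
      ((real p - of_bool (j = 0)) / (real p + real j + 1) * real (?N choose p)))"
  proof (intro sum.cong refl)
    fix K assume "K \<in> {K. K \<subseteq> {1..m} \<and> card K = k}"
    then have "card ({1..m} - K) = m - k"
      using fin by (simp add: card_Diff_subset)
    then show "(\<Sum>U | U \<subseteq> {1..m} - K \<and> card U = ?N.
        (real p - of_bool (j = 0)) / (real p + real j + 1) * real (?N choose p)) =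
      real ((m - k) choose ?N) * ((real p - of_bool (j = 0)) / (real p + real j + 1) * real (?N choose p))"
      by (simp add: n_subsets)
  qed
  also have "\<dots> = real (m choose k) * (real ((m - k) choose ?N) *
      ((real p - of_bool (j = 0)) / (real p + real j + 1) * real (?N choose p)))"
    by (simp add: n_subsets)
  finally show ?thesis
    using i by (simp add: ac_simps)
qed

text \<open>Swapping the two members matches the pairs with \<open>card A < card B\<close> with those with
\<open>card B < card A\<close>, so half of all pairs are counted by giving weight one to the latter and one half to the
pairs of equal height. The bounds on \<open>k\<close> and \<open>j\<close> hold because \<open>B\<close> is not a subset of \<open>A\<close>,
\<open>A \<union> B\<close> has at most \<open>m\<close> elements, and columns have height at most \<open>n\<close>.\<close>

lemma half_incomparable_pairs_as_sum:
  "real (card (incomparable_pairs n m)) / 2 =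
    (\<Sum>i = 1..n. \<Sum>k = max 0 (2 * i - m)..i - 1. \<Sum>j = 0..min (n - i) (m + k - 2 * i).
       (1 - 1 / 2 * of_bool (j = 0)) * real (card (incomparable_pairs_shape m i k j)))"
proof -
  let ?I = "incomparable_pairs n m"
  let ?lt = "{(A, B) \<in> ?I. card A < card B}"
  let ?gt = "{(A, B) \<in> ?I. card B < card A}"
  let ?eq = "{(A, B) \<in> ?I. card A = card B}"
  let ?ge = "{(A, B) \<in> ?I. card B \<le> card A}"
  let ?T = "SIGMA i:{1..n}. SIGMA k:{max 0 (2 * i - m)..i - 1}. {0..min (n - i) (m + k - 2 * i)}"
  let ?g = "\<lambda>(A, B). (card B, card (A \<inter> B), card A - card B)"
  let ?w = "\<lambda>j :: nat. 1 - 1 / 2 * of_bool (j = 0) :: real"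
  note fin = finite_subset[OF _ finite_incomparable_pairs[of n m]]
  have fins: "finite ?lt" "finite ?gt" "finite ?eq" "finite ?ge"
    by (rule fin, blast)+
  have "bij_betw prod.swap ?gt ?lt"
    by (rule bij_betwI[where g = prod.swap]) (auto simp: incomparable_pairs_def)
  then have swap: "card ?gt = card ?lt" by (rule bij_betw_same_card)
  have disj: "?eq \<inter> ?gt = {}" "(?eq \<union> ?gt) \<inter> ?lt = {}" by auto
  have ge: "?ge = ?eq \<union> ?gt" and all: "?I = (?eq \<union> ?gt) \<union> ?lt"
    by (auto simp: le_less)
  have "card ?I = card ?eq + card ?gt + card ?lt"
    by (subst all) (simp only: card_Un_disjoint fins disj finite_UnI)
  then have "real (card ?I) / 2 = (\<Sum>P\<in>?eq. 1 / 2) + (\<Sum>P\<in>?gt. 1)"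
    using swap by simp
  also have "\<dots> = (\<Sum>P\<in>?eq. ?w (card (fst P) - card (snd P))) + (\<Sum>P\<in>?gt. ?w (card (fst P) - card (snd P)))"
    by (intro arg_cong2[of _ _ _ _ "(+)"] sum.cong) auto
  also have "\<dots> = (\<Sum>P\<in>?ge. ?w (card (fst P) - card (snd P)))"
    unfolding ge by (rule sum.union_disjoint[symmetric]) (use fins disj in simp_all)
  also have "\<dots> = (\<Sum>y\<in>?T. \<Sum>P\<in>{P \<in> ?ge. ?g P = y}. ?w (card (fst P) - card (snd P)))"
  proof (rule sum.group[symmetric])
    show "?g ` ?ge \<subseteq> ?T"
    proof
      fix y assume "y \<in> ?g ` ?ge"
      then obtain P where "P \<in> ?ge" "y = ?g P"
        by blast
      then obtain A B where AB: "(A, B) \<in> ?ge" and y: "y = (card B, card (A \<inter> B), card A - card B)"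
        by (cases P) simp
      then have sets: "A \<in> column_sets n m" "B \<in> column_sets n m" and le: "card B \<le> card A"
        and inc: "\<not> entry A \<le> entry B"
        by (auto simp: incomparable_pairs_def)
      note f = column_sets_finite[OF sets(1)] column_sets_finite[OF sets(2)]
      have "B - A \<noteq> {}"
      proof
        assume "B - A = {}"
        then have "entry A \<le> entry B"
          unfolding entry_le_entry_iff[OF f] using f by (intro allI card_mono) auto
        then show False using inc by simp
      qed
      then have "A \<inter> B \<subset> B" by blast
      then have lt: "card (A \<inter> B) < card B"
        using f by (simp add: psubset_card_mono)
      have "A \<union> B \<subseteq> {1..m}" "card A \<le> n"
        using sets by (simp_all add: column_sets_def)
      then have "card (A \<union> B) \<le> m" "card A \<le> n"
        using card_mono[of "{1..m}" "A \<union> B"] by simp_all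
      moreover have "card A + card B = card (A \<union> B) + card (A \<inter> B)"
        using f by (rule card_Un_Int)
      ultimately show "y \<in> ?T"
        using lt le unfolding y by (auto simp: le_diff_conv)
    qed
  qed (use fins in simp_all)
  also have "\<dots> = (\<Sum>y\<in>?T. case y of (i, k, j) \<Rightarrow> ?w j * real (card (incomparable_pairs_shape m i k j)))"
  proof (intro sum.cong refl)
    fix y assume "y \<in> ?T"
    then obtain i k j where y: "y = (i, k, j)" and i: "1 \<le> i" "i + j \<le> n"
      by auto
    have "{P \<in> ?ge. ?g P = y} = incomparable_pairs_shape m i k j"
    proof (rule Set.set_eqI)
      fix P :: "nat set \<times> nat set"
      obtain A B where P: "P = (A, B)" by (cases P)
      have cards: "card B \<le> card A \<and> card B = i \<and> card A - card B = j \<longleftrightarrow> card A = i + j \<and> card B = i"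
        by auto
      have nonempty: "card A = i + j \<Longrightarrow> A \<noteq> {} \<and> card A \<le> n" "card B = i \<Longrightarrow> B \<noteq> {} \<and> card B \<le> n"
        using i by auto
      show "P \<in> {P \<in> ?ge. ?g P = y} \<longleftrightarrow> P \<in> incomparable_pairs_shape m i k j"
        unfolding P y incomparable_pairs_shape_def incomparable_pairs_def column_sets_def
          mem_Collect_eq split_conv prod.inject
        using cards nonempty by blast
    qed
    moreover have "?w (card (fst P) - card (snd P)) = ?w j" if "P \<in> incomparable_pairs_shape m i k j" for P
      using that by (auto simp: incomparable_pairs_shape_def)
    ultimately show "(\<Sum>P\<in>{P \<in> ?ge. ?g P = y}. ?w (card (fst P) - card (snd P))) =
        (case y of (i, k, j) \<Rightarrow> ?w j * real (card (incomparable_pairs_shape m i k j)))"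
      by (simp add: y)
  qed
  also have "\<dots> = (\<Sum>i = 1..n. \<Sum>k = max 0 (2 * i - m)..i - 1. \<Sum>j = 0..min (n - i) (m + k - 2 * i).
       ?w j * real (card (incomparable_pairs_shape m i k j)))"
    by (simp add: sum.Sigma split_def)
  finally show ?thesis .
qed

lemma half_incomparable_pairs:
  "real (card (incomparable_pairs n m)) / 2 =
    (\<Sum>i = 1..n. \<Sum>k = max 0 (2 * i - m)..i - 1. \<Sum>j = 0..min (n - i) (m + k - 2 * i).
       real (m choose k) * (1 - 1 / 2 * of_bool (j = 0)) *
       ((real i - real k - of_bool (j = 0)) / (real i + real j - real k + 1)) *
       real ((m - k) choose (2 * i + j - 2 * k)) *
       real ((2 * i + j - 2 * k) choose (i - k)))"
  unfolding half_incomparable_pairs_as_sum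
proof (intro sum.cong refl)
  fix i k j assume "i \<in> {1..n}" "k \<in> {max 0 (2 * i - m)..i - 1}"
  then have "k < i" by auto
  then show "(1 - 1 / 2 * of_bool (j = 0)) * real (card (incomparable_pairs_shape m i k j)) =
       real (m choose k) * (1 - 1 / 2 * of_bool (j = 0)) *
       ((real i - real k - of_bool (j = 0)) / (real i + real j - real k + 1)) *
       real ((m - k) choose (2 * i + j - 2 * k)) *
       real ((2 * i + j - 2 * k) choose (i - k))"
    by (simp only: card_incomparable_pairs_shape ac_simps)
qed

theorem theorem2p26:
  fixes m n :: nat
  assumes "1 \<le> n" and "n \<le> m"
  shows "real (min_generators
            (mvpoly_ring (one_column_tableaux n m)
               :: (tableau, 'k::{alg_closed_field, field_char_0}) mvpoly ring)
            (star_ideal n m)) =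
    (\<Sum>i = 1..n. \<Sum>k = max 0 (2 * i - m)..i - 1. \<Sum>j = 0..min (n - i) (m + k - 2 * i).
       real (m choose k) * (1 - 1 / 2 * of_bool (j = 0)) *
       ((real i - real k - of_bool (j = 0)) / (real i + real j - real k + 1)) *
       real ((m - k) choose (2 * i + j - 2 * k)) *
       real ((2 * i + j - 2 * k) choose (i - k)))"
proof -
  have "real (card (incomparable_pairs n m)) / 2 = real (min_generators
      (mvpoly_ring (one_column_tableaux n m) :: (tableau, 'k) mvpoly ring) (star_ideal n m))"
    by (simp add: min_generators_star_ideal card_incomparable_pairs)
  then show ?thesis
    by (simp only: half_incomparable_pairs)
qed

end
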